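(* Let $N_1$ and $N_2$ be lattices of finite rank and let $(\mathfrak S_i,\mathfrak P_i)$ be a partitioned fan in $(N_i)_{\mathbb R}$ for $i=1,2$. Let $f:((N_1)_{\mathbb R},\mathfrak S_1,\mathfrak P_1)\to((N_2)_{\mathbb R},\mathfrak S_2,\mathfrak P_2)$ be a morphism of partitioned fans. (1) The morphism $f$ induces a functor $\mathfrak C f:\mathfrak C(\mathfrak S_1,\mathfrak P_1)\to\mathfrak C(\mathfrak S_2,\mathfrak P_2)$, sending the object $[\![\sigma]\!]$ to $[\![\sigma^f]\!]$ and the morphism $[\![{\kappa\atop\sigma}]\!]$ to $[\![{\kappa^f\atop\sigma^f}]\!]$. (2) If $f$ is injective, then the functor $\mathfrak C f$ is faithful. (3) If $f$ is surjective, then the functor $\mathfrak C f$ is dense. (4) Suppose that $\mathfrak C f$ admits a right adjoint $R$. Then all objects in $\mathfrak C(\mathfrak S_1,\mathfrak P_1)$ of the form $[\![\mu]\!]$, where $\mu$ is a maximal cone in $\mathfrak S_1$, are in the essential image of $R$.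
   Context: **Partitioned fans.** A polyhedral fan in $N_{\mathbb R}=N\otimes_{\mathbb Z}\mathbb R$ is a (possibly infinite) family of strongly convex polyhedral cones closed under faces such that the intersection of two cones is a face of both; simplicial means every cone is spanned by linearly independent vectors. A cone is maximal if not properly contained in another cone of the fan. Let $\mathfrak S$ be a simplicial fan in $N_{\mathbb R}$ with a fixed inner product. For $\sigma\in\mathfrak S$, $\sigma^\perp$ is the orthogonal complement of $\mathrm{span}(\sigma)$, $\pi_\sigma:N_{\mathbb R}\to\sigma^\perp$ is orthogonal projection, and $\mathrm{star}(\sigma)=\{\tau\in\mathfrak S:\sigma\subseteq\tau\}$. Let $\mathcal E_\sigma=\{\kappa\in\mathfrak S:\sigma^\perp=\kappa^\perp,\ \pi_\sigma(\mathrm{star}(\sigma))=\pi_\kappa(\mathrm{star}(\kappa))\}$ (images taken as sets of cones). A partition $\mathfrak P$ of $\mathfrak S$ is a partition of each $\mathcal E_\sigma$ (depending only on the set $\mathcal E_\sigma$); write $\sigma_1\sim_{\mathfrak P}\sigma_2$ if they lie in a common block. It is admissible if $\sigma_1\sim\sigma_2$ and $\pi_{\sigma_1}(\kappa_1)=\pi_{\sigma_2}(\kappa_2)$ with $\kappa_i\in\mathrm{star}(\sigma_i)$ imply $\kappa_1\sim\kappa_2$. A partitioned fan is a simplicial fan with an admissible partition. **Category.** $\mathfrak C(\mathfrak S,\mathfrak P)$ has as objects the classes $[\![\sigma]\!]$; morphisms $[\![\sigma]\!]\to[\![\rho]\!]$ are symbols $\binom{\rho_1}{\sigma_1}$ with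 $\sigma_1\sim\sigma$, $\rho_1\sim\rho$, $\sigma_1\subseteq\rho_1$, modulo identifying $\binom{\rho_1}{\sigma_1}$ and $\binom{\rho_2}{\sigma_2}$ when $\pi_{\sigma_1}(\rho_1)=\pi_{\sigma_2}(\rho_2)$; the class of $\binom\rho\sigma$ is $[\![{\rho\atop\sigma}]\!]$, and $[\![{\rho\atop\kappa}]\!]\circ[\![{\kappa\atop\sigma}]\!]=[\![{\rho\atop\sigma}]\!]$. This is a well-defined category. **Morphisms.** A morphism of fans $f:((N_1)_{\mathbb R},\mathfrak S_1)\to((N_2)_{\mathbb R},\mathfrak S_2)$ is an $\mathbb R$-linear map such that each $f(\sigma)$, $\sigma\in\mathfrak S_1$, lies in some cone of $\mathfrak S_2$; $\sigma^f$ denotes the unique minimal cone of $\mathfrak S_2$ containing $f(\sigma)$. It is a morphism of partitioned fans if $\sigma_1\sim_{\mathfrak P_1}\sigma_2$ implies $\sigma_1^f\sim_{\mathfrak P_2}\sigma_2^f$. It is injective if $\sigma_1^f=\sigma_2^f$ implies $\sigma_1=\sigma_2$, and surjective if every cone of $\mathfrak S_2$ equals $\sigma^f$ for some $\sigma\in\mathfrak S_1$. *)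

theory Defs
  imports "HOL-Analysis.Analysis" "HOL-Library.Disjoint_Sets"
begin

record ('o, 'm) cat =
  Obj :: "'o set"
  Hom :: "'o \<Rightarrow> 'o \<Rightarrow> 'm set"
  Idn :: "'o \<Rightarrow> 'm"
  Cmp :: "'m \<Rightarrow> 'm \<Rightarrow> 'm"  \<comment> \<open>\<open>Cmp C g f\<close> is \<open>g\<close> after \<open>f\<close>\<close>

text \<open>Every arrow has a unique domain and codomain, so the arrow part of a functor can be given
  as a single map.\<close>

definition category :: "('o, 'm) cat \<Rightarrow> bool" where
  "category C \<longleftrightarrow>
     (\<forall>A\<in>Obj C. \<forall>B\<in>Obj C. \<forall>A'\<in>Obj C. \<forall>B'\<in>Obj C.
        Hom C A B \<inter> Hom C A' B' \<noteq> {} \<longrightarrow> A = A' \<and> B = B') \<and>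
     (\<forall>A\<in>Obj C. Idn C A \<in> Hom C A A) \<and>
     (\<forall>A\<in>Obj C. \<forall>B\<in>Obj C. \<forall>D\<in>Obj C. \<forall>f\<in>Hom C A B. \<forall>g\<in>Hom C B D. Cmp C g f \<in> Hom C A D) \<and>
     (\<forall>A\<in>Obj C. \<forall>B\<in>Obj C. \<forall>f\<in>Hom C A B. Cmp C f (Idn C A) = f \<and> Cmp C (Idn C B) f = f) \<and>
     (\<forall>A\<in>Obj C. \<forall>B\<in>Obj C. \<forall>D\<in>Obj C. \<forall>E\<in>Obj C.
        \<forall>f\<in>Hom C A B. \<forall>g\<in>Hom C B D. \<forall>h\<in>Hom C D E.
          Cmp C h (Cmp C g f) = Cmp C (Cmp C h g) f)"

definition isomorphic_in :: "('o, 'm) cat \<Rightarrow> 'o \<Rightarrow> 'o \<Rightarrow> bool" where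
  "isomorphic_in C A B \<longleftrightarrow>
     (\<exists>f\<in>Hom C A B. \<exists>g\<in>Hom C B A. Cmp C g f = Idn C A \<and> Cmp C f g = Idn C B)"

record ('o1, 'm1, 'o2, 'm2) fctr =
  omap :: "'o1 \<Rightarrow> 'o2"
  amap :: "'m1 \<Rightarrow> 'm2"

definition is_functor :: "('o1, 'm1) cat \<Rightarrow> ('o2, 'm2) cat \<Rightarrow> ('o1, 'm1, 'o2, 'm2) fctr \<Rightarrow> bool" where
  "is_functor C D F \<longleftrightarrow> category C \<and> category D \<and>
     (\<forall>A\<in>Obj C. omap F A \<in> Obj D) \<and>
     (\<forall>A\<in>Obj C. \<forall>B\<in>Obj C. \<forall>f\<in>Hom C A B. amap F f \<in> Hom D (omap F A) (omap F B)) \<and>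
     (\<forall>A\<in>Obj C. amap F (Idn C A) = Idn D (omap F A)) \<and>
     (\<forall>A\<in>Obj C. \<forall>B\<in>Obj C. \<forall>E\<in>Obj C. \<forall>f\<in>Hom C A B. \<forall>g\<in>Hom C B E.
        amap F (Cmp C g f) = Cmp D (amap F g) (amap F f))"

definition faithful :: "('o1, 'm1) cat \<Rightarrow> ('o2, 'm2) cat \<Rightarrow> ('o1, 'm1, 'o2, 'm2) fctr \<Rightarrow> bool" where
  "faithful C D F \<longleftrightarrow> is_functor C D F \<and> (\<forall>A\<in>Obj C. \<forall>B\<in>Obj C. inj_on (amap F) (Hom C A B))"

definition essential_image ::
    "('o1, 'm1) cat \<Rightarrow> ('o2, 'm2) cat \<Rightarrow> ('o1, 'm1, 'o2, 'm2) fctr \<Rightarrow> 'o2 set" where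
  "essential_image C D F = {B \<in> Obj D. \<exists>A\<in>Obj C. isomorphic_in D (omap F A) B}"

text \<open>Dense functors are also called essentially surjective.\<close>

definition dense_functor :: "('o1, 'm1) cat \<Rightarrow> ('o2, 'm2) cat \<Rightarrow> ('o1, 'm1, 'o2, 'm2) fctr \<Rightarrow> bool" where
  "dense_functor C D F \<longleftrightarrow> is_functor C D F \<and> essential_image C D F = Obj D"

definition right_adjoint :: "('o1, 'm1) cat \<Rightarrow> ('o2, 'm2) cat \<Rightarrow>
    ('o1, 'm1, 'o2, 'm2) fctr \<Rightarrow> ('o2, 'm2, 'o1, 'm1) fctr \<Rightarrow> bool" where
  "right_adjoint C D F R \<longleftrightarrow> is_functor C D F \<and> is_functor D C R \<and>
     (\<exists>\<phi>. (\<forall>A\<in>Obj C. \<forall>B\<in>Obj D. bij_betw (\<phi> A B) (Hom D (omap F A) B) (Hom C A (omap R B))) \<and>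
        (\<forall>A\<in>Obj C. \<forall>A'\<in>Obj C. \<forall>B\<in>Obj D. \<forall>B'\<in>Obj D.
           \<forall>a\<in>Hom C A' A. \<forall>b\<in>Hom D B B'. \<forall>g\<in>Hom D (omap F A) B.
             \<phi> A' B' (Cmp D b (Cmp D g (amap F a))) = Cmp C (amap R b) (Cmp C (\<phi> A B g) a)))"

text \<open>The space \<open>N\<^sub>\<real>\<close> is the whole type: \<open>N\<close> is the integral span of a finite
  real basis. Class \<open>real_inner\<close> is used rather than \<open>euclidean_space\<close>, since the latter
  excludes rank 0. The inner product of the type is the fixed one.\<close>

definition lattice_of_finite_rank :: "'a::real_vector set \<Rightarrow> bool" where
  "lattice_of_finite_rank N \<longleftrightarrow>
     (\<exists>B. finite B \<and> independent B \<and> span B = UNIV \<and>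
          N = {(\<Sum>b\<in>B. of_int (c b) *\<^sub>R b) | c :: 'a \<Rightarrow> int. True})"

definition polyhedral_cone :: "'a::real_vector set \<Rightarrow> bool" where
  "polyhedral_cone \<sigma> \<longleftrightarrow> (\<exists>V. finite V \<and> \<sigma> = convex_cone hull V)"

definition strongly_convex :: "'a::real_vector set \<Rightarrow> bool" where
  "strongly_convex \<sigma> \<longleftrightarrow> convex \<sigma> \<and> (\<forall>x. x \<in> \<sigma> \<and> - x \<in> \<sigma> \<longrightarrow> x = 0)"

text \<open>The library counts the empty set as a face of every convex set; it is not a cone.\<close>

definition fan :: "'a::real_vector set set \<Rightarrow> bool" where
  "fan S \<longleftrightarrow> (\<forall>\<sigma>\<in>S. polyhedral_cone \<sigma> \<and> strongly_convex \<sigma>) \<and>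
     (\<forall>\<sigma>\<in>S. \<forall>\<tau>. \<tau> face_of \<sigma> \<and> \<tau> \<noteq> {} \<longrightarrow> \<tau> \<in> S) \<and>
     (\<forall>\<sigma>\<in>S. \<forall>\<tau>\<in>S. (\<sigma> \<inter> \<tau>) face_of \<sigma> \<and> (\<sigma> \<inter> \<tau>) face_of \<tau>)"

definition simplicial_fan :: "'a::real_vector set set \<Rightarrow> bool" where
  "simplicial_fan S \<longleftrightarrow> fan S \<and> (\<forall>\<sigma>\<in>S. \<exists>V. finite V \<and> independent V \<and> \<sigma> = convex_cone hull V)"

definition maximal_cone :: "'a set set \<Rightarrow> 'a set \<Rightarrow> bool" where
  "maximal_cone S \<mu> \<longleftrightarrow> \<mu> \<in> S \<and> \<not> (\<exists>\<tau>\<in>S. \<mu> \<subset> \<tau>)"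

definition cperp :: "'a::real_inner set \<Rightarrow> 'a set" where
  "cperp \<sigma> = (span \<sigma>)\<^sup>\<bottom>"

definition cproj :: "'a::real_inner set \<Rightarrow> 'a \<Rightarrow> 'a" where
  "cproj \<sigma> x = (THE y. y \<in> cperp \<sigma> \<and> x - y \<in> span \<sigma>)"

definition star :: "'a set set \<Rightarrow> 'a set \<Rightarrow> 'a set set" where
  "star S \<sigma> = {\<tau> \<in> S. \<sigma> \<subseteq> \<tau>}"

definition same_star :: "'a::real_inner set set \<Rightarrow> 'a set \<Rightarrow> 'a set set" where
  "same_star S \<sigma> = {\<kappa> \<in> S. cperp \<sigma> = cperp \<kappa> \<and>
     (\<lambda>\<tau>. cproj \<sigma> ` \<tau>) ` star S \<sigma> = (\<lambda>\<tau>. cproj \<kappa> ` \<tau>) ` star S \<kappa>}"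

text \<open>A partition assigns to each set \<open>same_star S \<sigma>\<close> a partition of that set; being a function
  of the set, it does not depend on the choice of \<open>\<sigma>\<close>.\<close>

definition fan_partition :: "'a::real_inner set set \<Rightarrow> ('a set set \<Rightarrow> 'a set set set) \<Rightarrow> bool" where
  "fan_partition S P \<longleftrightarrow> (\<forall>\<sigma>\<in>S. partition_on (same_star S \<sigma>) (P (same_star S \<sigma>)))"

definition pequiv ::
    "'a::real_inner set set \<Rightarrow> ('a set set \<Rightarrow> 'a set set set) \<Rightarrow> 'a set \<Rightarrow> 'a set \<Rightarrow> bool" where
  "pequiv S P \<sigma>\<^sub>1 \<sigma>\<^sub>2 \<longleftrightarrow> (\<exists>\<sigma>\<in>S. \<exists>b\<in>P (same_star S \<sigma>). \<sigma>\<^sub>1 \<in> b \<and> \<sigma>\<^sub>2 \<in> b)"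

definition admissible :: "'a::real_inner set set \<Rightarrow> ('a set set \<Rightarrow> 'a set set set) \<Rightarrow> bool" where
  "admissible S P \<longleftrightarrow>
     (\<forall>\<sigma>\<^sub>1 \<sigma>\<^sub>2. pequiv S P \<sigma>\<^sub>1 \<sigma>\<^sub>2 \<longrightarrow>
        (\<forall>\<kappa>\<^sub>1\<in>star S \<sigma>\<^sub>1. \<forall>\<kappa>\<^sub>2\<in>star S \<sigma>\<^sub>2.
           cproj \<sigma>\<^sub>1 ` \<kappa>\<^sub>1 = cproj \<sigma>\<^sub>2 ` \<kappa>\<^sub>2 \<longrightarrow> pequiv S P \<kappa>\<^sub>1 \<kappa>\<^sub>2))"

definition partitioned_fan :: "'a::real_inner set set \<Rightarrow> ('a set set \<Rightarrow> 'a set set set) \<Rightarrow> bool" where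
  "partitioned_fan S P \<longleftrightarrow> simplicial_fan S \<and> fan_partition S P \<and> admissible S P"

definition cls :: "'a::real_inner set set \<Rightarrow> ('a set set \<Rightarrow> 'a set set set) \<Rightarrow> 'a set \<Rightarrow> 'a set set" where
  "cls S P \<sigma> = {\<tau>. pequiv S P \<sigma> \<tau>}"

text \<open>The pair \<open>(\<rho>, \<sigma>)\<close> encodes the symbol with upper entry \<open>\<rho>\<close> and lower entry \<open>\<sigma>\<close>;
  \<open>symbols A B\<close> are those from the object \<open>A\<close> to the object \<open>B\<close>.\<close>

definition symbols :: "'a set set \<Rightarrow> 'a set set \<Rightarrow> ('a set \<times> 'a set) set" where
  "symbols A B = {(\<rho>, \<sigma>). \<sigma> \<in> A \<and> \<rho> \<in> B \<and> \<sigma> \<subseteq> \<rho>}"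

definition symrel :: "'a::real_inner set set \<Rightarrow> 'a set set \<Rightarrow> (('a set \<times> 'a set) \<times> ('a set \<times> 'a set)) set" where
  "symrel A B = {((\<rho>\<^sub>1, \<sigma>\<^sub>1), (\<rho>\<^sub>2, \<sigma>\<^sub>2)).
     (\<rho>\<^sub>1, \<sigma>\<^sub>1) \<in> symbols A B \<and> (\<rho>\<^sub>2, \<sigma>\<^sub>2) \<in> symbols A B \<and> cproj \<sigma>\<^sub>1 ` \<rho>\<^sub>1 = cproj \<sigma>\<^sub>2 ` \<rho>\<^sub>2}"

definition mor :: "'a::real_inner set set \<Rightarrow> ('a set set \<Rightarrow> 'a set set set) \<Rightarrow>
    'a set \<Rightarrow> 'a set \<Rightarrow> ('a set \<times> 'a set) set" where
  "mor S P \<rho> \<sigma> = symrel (cls S P \<sigma>) (cls S P \<rho>) `` {(\<rho>, \<sigma>)}"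

definition fan_cat :: "'a::real_inner set set \<Rightarrow> ('a set set \<Rightarrow> 'a set set set) \<Rightarrow>
    ('a set set, ('a set \<times> 'a set) set) cat" where
  "fan_cat S P = \<lparr>
     Obj = cls S P ` S,
     Hom = (\<lambda>A B. symbols A B // symrel A B),
     Idn = (\<lambda>A. THE m. \<exists>\<sigma>\<in>A. m = mor S P \<sigma> \<sigma>),
     Cmp = (\<lambda>g f. THE m. \<exists>\<rho> \<kappa> \<sigma>. (\<kappa>, \<sigma>) \<in> f \<and> (\<rho>, \<kappa>) \<in> g \<and> m = mor S P \<rho> \<sigma>) \<rparr>"

definition fan_morphism ::
    "'a::real_vector set set \<Rightarrow> 'b::real_vector set set \<Rightarrow> ('a \<Rightarrow> 'b) \<Rightarrow> bool" where
  "fan_morphism S\<^sub>1 S\<^sub>2 f \<longleftrightarrow> linear f \<and> (\<forall>\<sigma>\<in>S\<^sub>1. \<exists>\<tau>\<in>S\<^sub>2. f ` \<sigma> \<subseteq> \<tau>)"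

text \<open>\<open>fcone S\<^sub>2 f \<sigma>\<close> is the cone \<open>\<sigma>\<^sup>f\<close>.\<close>

definition fcone :: "'b set set \<Rightarrow> ('a \<Rightarrow> 'b) \<Rightarrow> 'a set \<Rightarrow> 'b set" where
  "fcone S\<^sub>2 f \<sigma> =
     (THE \<tau>. \<tau> \<in> S\<^sub>2 \<and> f ` \<sigma> \<subseteq> \<tau> \<and> (\<forall>\<rho>\<in>S\<^sub>2. f ` \<sigma> \<subseteq> \<rho> \<and> \<rho> \<subseteq> \<tau> \<longrightarrow> \<rho> = \<tau>))"

definition pfan_morphism ::
    "'a::real_inner set set \<Rightarrow> ('a set set \<Rightarrow> 'a set set set) \<Rightarrow>
     'b::real_inner set set \<Rightarrow> ('b set set \<Rightarrow> 'b set set set) \<Rightarrow> ('a \<Rightarrow> 'b) \<Rightarrow> bool" where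
  "pfan_morphism S\<^sub>1 P\<^sub>1 S\<^sub>2 P\<^sub>2 f \<longleftrightarrow> fan_morphism S\<^sub>1 S\<^sub>2 f \<and>
     (\<forall>\<sigma>\<^sub>1 \<sigma>\<^sub>2. pequiv S\<^sub>1 P\<^sub>1 \<sigma>\<^sub>1 \<sigma>\<^sub>2 \<longrightarrow> pequiv S\<^sub>2 P\<^sub>2 (fcone S\<^sub>2 f \<sigma>\<^sub>1) (fcone S\<^sub>2 f \<sigma>\<^sub>2))"

definition injective_fan_morphism :: "'a set set \<Rightarrow> 'b set set \<Rightarrow> ('a \<Rightarrow> 'b) \<Rightarrow> bool" where
  "injective_fan_morphism S\<^sub>1 S\<^sub>2 f \<longleftrightarrow>
     (\<forall>\<sigma>\<^sub>1\<in>S\<^sub>1. \<forall>\<sigma>\<^sub>2\<in>S\<^sub>1. fcone S\<^sub>2 f \<sigma>\<^sub>1 = fcone S\<^sub>2 f \<sigma>\<^sub>2 \<longrightarrow> \<sigma>\<^sub>1 = \<sigma>\<^sub>2)"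

definition surjective_fan_morphism :: "'a set set \<Rightarrow> 'b set set \<Rightarrow> ('a \<Rightarrow> 'b) \<Rightarrow> bool" where
  "surjective_fan_morphism S\<^sub>1 S\<^sub>2 f \<longleftrightarrow> (\<forall>\<tau>\<in>S\<^sub>2. \<exists>\<sigma>\<in>S\<^sub>1. \<tau> = fcone S\<^sub>2 f \<sigma>)"

text \<open>The assignments of the induced functor on representatives; independence of the
  representatives is not built in.\<close>

definition induced_functor ::
    "'a::real_inner set set \<Rightarrow> ('a set set \<Rightarrow> 'a set set set) \<Rightarrow>
     'b::real_inner set set \<Rightarrow> ('b set set \<Rightarrow> 'b set set set) \<Rightarrow> ('a \<Rightarrow> 'b) \<Rightarrow>
     ('a set set, ('a set \<times> 'a set) set, 'b set set, ('b set \<times> 'b set) set) fctr" where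
  "induced_functor S\<^sub>1 P\<^sub>1 S\<^sub>2 P\<^sub>2 f = \<lparr>
     omap = (\<lambda>A. THE B. \<exists>\<sigma>\<in>S\<^sub>1. A = cls S\<^sub>1 P\<^sub>1 \<sigma> \<and> B = cls S\<^sub>2 P\<^sub>2 (fcone S\<^sub>2 f \<sigma>)),
     amap = (\<lambda>m. THE n. \<exists>\<sigma>\<in>S\<^sub>1. \<exists>\<kappa>\<in>S\<^sub>1. \<sigma> \<subseteq> \<kappa> \<and> m = mor S\<^sub>1 P\<^sub>1 \<kappa> \<sigma> \<and>
               n = mor S\<^sub>2 P\<^sub>2 (fcone S\<^sub>2 f \<kappa>) (fcone S\<^sub>2 f \<sigma>)) \<rparr>"

end

theory Submission
  imports Defs
begin

text \<open>
  Everything rests on one property of stars: the projection along \<open>\<sigma>\<close> is injective on the cones that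
  contain \<open>\<sigma>\<close>, even pointwise (\<open>star_mem_of_cproj_mem\<close>): if \<open>\<tau>\<close> and \<open>\<kappa>\<close> contain \<open>\<sigma>\<close>, then a point
  of \<open>\<tau>\<close> whose projection lies in that of \<open>\<kappa>\<close> lies in \<open>\<kappa>\<close>. Indeed it can be moved into \<open>\<kappa>\<close> by adding
  an element of \<open>\<sigma>\<close>, and \<open>\<tau> \<inter> \<kappa>\<close> is a face of \<open>\<tau>\<close>.

  Equivalent cones have equal spans and equally projected stars. Hence a cone of one star can be lifted to
  the star of an equivalent cone with the same projection, and by admissibility the lift is equivalent to
  the original (\<open>pequiv_lift_star\<close>). So any morphism can be represented with a prescribed lower entry, and
  composable morphisms are represented by chains \<open>\<sigma> \<subseteq> \<kappa> \<subseteq> \<rho>\<close>. Injectivity on stars makes the composite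
  independent of representatives (\<open>comp_cproj_eq\<close>), and the laws of a category and of a functor are then
  read off from chains.

  The induced functor is well defined on morphisms for the same reason (\<open>fcone_cproj_subset\<close>): \<open>f\<close> maps
  the span of \<open>\<sigma>\<close> into that of \<open>\<sigma>\<^sup>f\<close>, so cones with equal projections along equivalent cones have images
  whose minimal cones again have equal projections. For faithfulness, two parallel morphisms are given the
  same lower entry \<open>\<sigma>\<close>; if their images agree, injectivity on the star of \<open>\<sigma>\<^sup>f\<close> and injectivity of \<open>f\<close>
  identify their upper entries. Density is immediate from surjectivity. Finally, a morphism whose domain
  is the class of a maximal cone \<open>\<mu>\<close> has the same class as codomain. This applies to the unit of an
  adjunction with right adjoint \<open>R\<close>, so \<open>R\<close> sends the image of this class under the induced functor back
  to the class itself.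
\<close>

section \<open>Orthogonal projection along a cone\<close>

text \<open>The orthogonal projection onto the span of finitely many vectors, computed from an orthogonal
  spanning set. A zero vector in that set is harmless: its coefficient is \<open>0 / 0 = 0\<close>.\<close>

lemma finite_span_orthogonal_decomposition:
  fixes x :: "'a::real_inner"
  assumes "finite V"
  shows "\<exists>y. y \<in> (span V)\<^sup>\<bottom> \<and> x - y \<in> span V"
proof -
  obtain C where C: "finite C" "span C = span V" "pairwise orthogonal C"
    using basis_orthogonal[OF assms] by blast
  define p where "p = (\<Sum>c\<in>C. (c \<bullet> x / (c \<bullet> c)) *\<^sub>R c)"
  have pV: "p \<in> span V"
    unfolding p_def C(2)[symmetric] by (intro span_sum span_scale span_base)
  have "d \<bullet> (x - p) = 0" if d: "d \<in> C" for d
  proof -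
    have "d \<bullet> p = (\<Sum>c\<in>C. (c \<bullet> x / (c \<bullet> c)) * (d \<bullet> c))"
      by (simp add: p_def inner_sum_right)
    also have "\<dots> = (\<Sum>c\<in>C. if c = d then d \<bullet> x else 0)"
      using C(3) d by (intro sum.cong) (auto simp: pairwise_def orthogonal_def)
    also have "\<dots> = d \<bullet> x"
      using C(1) d by simp
    finally show ?thesis by (simp add: inner_diff_right)
  qed
  then have "orthogonal (x - p) d" if "d \<in> span C" for d
    by (intro orthogonal_to_span[OF that]) (simp add: orthogonal_def inner_commute)
  then have "x - p \<in> (span V)\<^sup>\<bottom>"
    unfolding orthogonal_comp_def C(2) mem_Collect_eq by (blast intro: orthogonal_commute[THEN iffD1])
  then show ?thesis using pV by (intro exI[of _ "x - p"]) simp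
qed

lemma polyhedral_cone_span:
  assumes "polyhedral_cone \<sigma>"
  obtains V where "finite V" "span \<sigma> = span V"
proof -
  obtain V where V: "finite V" "\<sigma> = convex_cone hull V"
    using assms by (auto simp: polyhedral_cone_def)
  have "\<sigma> \<subseteq> span V"
    using V(2) by (simp add: convex_cone_span hull_minimal span_superset)
  moreover have "V \<subseteq> span \<sigma>"
    using V(2) by (meson hull_subset span_superset subset_trans)
  ultimately have "span \<sigma> = span V"
    by (simp add: span_eq)
  then show ?thesis using V(1) that by blast
qed

lemma orthogonal_decomposition_unique:
  fixes x :: "'a::real_inner"
  assumes "y \<in> (span V)\<^sup>\<bottom>" "x - y \<in> span V" "z \<in> (span V)\<^sup>\<bottom>" "x - z \<in> span V"
  shows "y = z"
proof -
  have "y - z \<in> span V"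
    using span_diff[OF assms(4,2)] by simp
  moreover have "y - z \<in> (span V)\<^sup>\<bottom>"
    using assms subspace_orthogonal_comp subspace_diff by blast
  ultimately have "(y - z) \<bullet> (y - z) = 0"
    unfolding orthogonal_comp_def orthogonal_def by blast
  then show ?thesis by simp
qed

lemma cproj_works:
  assumes "polyhedral_cone \<sigma>"
  shows "cproj \<sigma> x \<in> cperp \<sigma> \<and> x - cproj \<sigma> x \<in> span \<sigma>"
proof -
  obtain V where "finite V" "span \<sigma> = span V"
    using assms by (rule polyhedral_cone_span)
  then obtain y where y: "y \<in> cperp \<sigma>" "x - y \<in> span \<sigma>"
    using finite_span_orthogonal_decomposition[of V x] by (auto simp: cperp_def)
  show ?thesis
    unfolding cproj_def
    by (rule theI[where a = y])
       (use y orthogonal_decomposition_unique in \<open>auto simp: cperp_def\<close>)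
qed

lemma cproj_eq_iff:
  assumes "polyhedral_cone \<sigma>"
  shows "cproj \<sigma> x = cproj \<sigma> y \<longleftrightarrow> x - y \<in> span \<sigma>"
proof
  assume eq: "cproj \<sigma> x = cproj \<sigma> y"
  have "(x - cproj \<sigma> x) - (y - cproj \<sigma> y) \<in> span \<sigma>"
    by (rule span_diff) (simp_all add: cproj_works[OF assms])
  then show "x - y \<in> span \<sigma>" by (simp add: eq)
next
  assume xy: "x - y \<in> span \<sigma>"
  have "(x - y) + (y - cproj \<sigma> y) \<in> span \<sigma>"
    by (rule span_add[OF xy]) (simp add: cproj_works[OF assms])
  then have mem: "x - cproj \<sigma> y \<in> span \<sigma>" by simp
  show "cproj \<sigma> x = cproj \<sigma> y"
    by (rule orthogonal_decomposition_unique[OF _ _ _ mem])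
       (simp_all add: cproj_works[OF assms] cperp_def[symmetric])
qed

text \<open>The span is recovered from its orthogonal complement because it is finite dimensional: a vector
  orthogonal to the complement has projection orthogonal to itself.\<close>

lemma span_subset_of_cperp_eq:
  assumes "polyhedral_cone \<kappa>" "cperp \<sigma> = cperp \<kappa>"
  shows "span \<sigma> \<subseteq> span \<kappa>"
proof
  fix x assume x: "x \<in> span \<sigma>"
  define y where "y = cproj \<kappa> x"
  have y: "y \<in> cperp \<kappa>" "x - y \<in> span \<kappa>"
    using cproj_works[OF assms(1)] by (auto simp: y_def)
  have "x \<bullet> y = 0"
    using y(1) x assms(2) by (auto simp: cperp_def orthogonal_comp_def orthogonal_def)
  moreover have "(x - y) \<bullet> y = 0"
    using y unfolding cperp_def orthogonal_comp_def orthogonal_def by blast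
  ultimately have "y = 0" by (simp add: inner_diff_left)
  then show "x \<in> span \<kappa>" using y(2) by simp
qed

lemma span_eq_of_cperp_eq:
  assumes "polyhedral_cone \<sigma>" "polyhedral_cone \<kappa>" "cperp \<sigma> = cperp \<kappa>"
  shows "span \<sigma> = span \<kappa>"
  using span_subset_of_cperp_eq assms by (metis subset_antisym)

lemma cproj_cong_span: "span \<sigma> = span \<kappa> \<Longrightarrow> cproj \<sigma> = cproj \<kappa>"
  by (simp add: cproj_def[abs_def] cperp_def)

section \<open>Faces of polyhedral cones\<close>

lemma polyhedral_cone_imp_convex_cone: "polyhedral_cone \<sigma> \<Longrightarrow> convex_cone \<sigma>"
  by (auto simp: polyhedral_cone_def convex_cone_convex_cone_hull)

text \<open>For \<open>d > 1\<close>, a nonzero point \<open>x\<close> is interior to the segment from \<open>0\<close> to \<open>d x\<close>, so both ends lie in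
  the face; smaller multiples follow by convexity.\<close>

lemma face_of_cone_scaleR:
  assumes C: "convex_cone C" and F: "F face_of C" and xF: "x \<in> F" and c: "0 \<le> c"
  shows "c *\<^sub>R x \<in> F"
proof (cases "x = 0")
  case True
  then show ?thesis using xF by simp
next
  case nz: False
  have xC: "x \<in> C" using F xF by (auto simp: face_of_def)
  have large: "0 \<in> F \<and> d *\<^sub>R x \<in> F" if "d > 1" for d
  proof -
    have "x \<in> open_segment 0 (d *\<^sub>R x)"
      using nz that unfolding in_segment by (intro conjI exI[of _ "1/d"]) auto
    moreover have "d *\<^sub>R x \<in> C"
      using that by (intro convex_cone_scaleR[OF C _ xC]) simp
    ultimately show ?thesis
      using face_ofD[OF F _ convex_cone_contains_0[OF C] _ xF] by blast
  qed
  show ?thesis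
  proof (cases "c > 1")
    case True
    then show ?thesis using large by blast
  next
    case False
    have "convex F" using F by (simp add: face_of_def)
    moreover have "0 \<in> F" using large[of 2] by simp
    ultimately show ?thesis
      using convexD[of F 0 x "1 - c" c] c False xF by simp
  qed
qed

text \<open>The library definition of a face speaks of open segments; for a cone it amounts to closure under
  summands.\<close>

lemma face_of_cone_add:
  assumes C: "convex_cone C" and F: "F face_of C" and xC: "x \<in> C" and yC: "y \<in> C"
    and xyF: "x + y \<in> F"
  shows "x \<in> F"
proof -
  have mid: "(1/2) *\<^sub>R (x + y) \<in> F"
    using face_of_cone_scaleR[OF C F xyF] by simp
  show ?thesis
  proof (cases "x = y")
    case True
    then show ?thesis using mid by (simp add: scaleR_2[symmetric])
  next
    case False
    have "(1/2) *\<^sub>R (x + y) \<in> open_segment x y"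
      using False unfolding in_segment
      by (intro conjI exI[of _ "1/2"]) (auto simp: scaleR_add_right)
    then show ?thesis using face_ofD[OF F] xC yC mid by blast
  qed
qed

text \<open>The generators that a face contains determine it, so a polyhedral cone has finitely many faces; this
  is why minimal cones exist in an infinite fan. The points of the hull whose membership in \<open>F\<close> implies
  membership in \<open>F'\<close> form a convex cone, because a face contains the summands of its points, and that
  cone contains all generators.\<close>

lemma face_of_cone_hull_subset:
  assumes F: "F face_of convex_cone hull V"
    and coneF': "convex_cone F'" and sub: "V \<inter> F \<subseteq> F'"
  shows "F \<subseteq> F'"
proof
  fix x assume x: "x \<in> F"
  let ?H = "convex_cone hull V"
  have C: "convex_cone ?H" by (rule convex_cone_convex_cone_hull)
  let ?D = "{x \<in> ?H. x \<in> F \<longrightarrow> x \<in> F'}"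
  have "convex_cone ?D"
  proof (rule convex_cone_iff[THEN iffD2], intro conjI ballI allI impI)
    show "0 \<in> ?D" using C coneF' by (simp add: convex_cone_contains_0)
  next
    fix a b assume a: "a \<in> ?D" and b: "b \<in> ?D"
    show "a + b \<in> ?D"
    proof (intro CollectI conjI impI)
      show "a + b \<in> ?H" using a b C by (simp add: convex_cone_add)
      assume ab: "a + b \<in> F"
      have "a \<in> F" "b \<in> F"
        using face_of_cone_add[OF C F, of a b] face_of_cone_add[OF C F, of b a] a b ab
        by (simp_all add: add.commute)
      then show "a + b \<in> F'" using a b coneF' by (simp add: convex_cone_add)
    qed
  next
    fix a :: 'a and c :: real assume a: "a \<in> ?D" and c: "0 \<le> c"
    show "c *\<^sub>R a \<in> ?D"
    proof (intro CollectI conjI impI)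
      show "c *\<^sub>R a \<in> ?H" using a c C by (simp add: convex_cone_scaleR)
      assume ca: "c *\<^sub>R a \<in> F"
      show "c *\<^sub>R a \<in> F'"
      proof (cases "c = 0")
        case True
        then show ?thesis using coneF' by (simp add: convex_cone_contains_0)
      next
        case False
        then have "a \<in> F"
          using face_of_cone_scaleR[OF C F ca, of "1 / c"] c by simp
        then show ?thesis using a c coneF' by (simp add: convex_cone_scaleR)
      qed
    qed
  qed
  moreover have "V \<subseteq> ?D"
    using sub by (auto simp: hull_inc)
  ultimately have "?H \<subseteq> ?D" by (rule hull_minimal[rotated])
  then show "x \<in> F'" using x F by (auto simp: face_of_def)
qed

lemma fan_polyhedral: "fan S \<Longrightarrow> \<sigma> \<in> S \<Longrightarrow> polyhedral_cone \<sigma>"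
  by (simp add: fan_def)

lemma fan_convex_cone: "fan S \<Longrightarrow> \<sigma> \<in> S \<Longrightarrow> convex_cone \<sigma>"
  by (simp add: fan_polyhedral polyhedral_cone_imp_convex_cone)

lemma fan_Int:
  assumes "fan S" "\<sigma> \<in> S" "\<tau> \<in> S"
  shows "\<sigma> \<inter> \<tau> \<in> S" "(\<sigma> \<inter> \<tau>) face_of \<sigma>"
proof -
  show face: "(\<sigma> \<inter> \<tau>) face_of \<sigma>" using assms by (simp add: fan_def)
  have "0 \<in> \<sigma> \<inter> \<tau>"
    using assms by (simp add: fan_convex_cone convex_cone_contains_0)
  then have "\<sigma> \<inter> \<tau> \<noteq> {}" by blast
  then show "\<sigma> \<inter> \<tau> \<in> S"
    using assms face unfolding fan_def by blast
qed

text \<open>Among the faces of one cone containing \<open>X\<close>, one with the fewest generators is minimal, hence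
  least, because the intersection of two cones of a fan is again a cone of the fan.\<close>

lemma fan_least_cone:
  assumes S: "fan S" and \<tau>: "\<tau> \<in> S" and X: "X \<subseteq> \<tau>"
  obtains \<rho> where "\<rho> \<in> S" "X \<subseteq> \<rho>" "\<And>\<rho>'. \<rho>' \<in> S \<Longrightarrow> X \<subseteq> \<rho>' \<Longrightarrow> \<rho> \<subseteq> \<rho>'"
proof -
  obtain V where V: "finite V" "\<tau> = convex_cone hull V"
    using fan_polyhedral[OF S \<tau>] by (auto simp: polyhedral_cone_def)
  define Q where "Q \<rho> \<longleftrightarrow> \<rho> \<in> S \<and> X \<subseteq> \<rho> \<and> \<rho> \<subseteq> \<tau>" for \<rho>
  have "Q \<tau>" using \<tau> X by (simp add: Q_def)
  then obtain \<rho> where \<rho>: "Q \<rho>" and least: "\<And>\<rho>'. Q \<rho>' \<Longrightarrow> card (V \<inter> \<rho>) \<le> card (V \<inter> \<rho>')"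
    using ex_has_least_nat[of Q \<tau> "\<lambda>\<rho>. card (V \<inter> \<rho>)"] by blast
  have "\<rho> \<subseteq> \<rho>'" if \<rho>': "\<rho>' \<in> S" "X \<subseteq> \<rho>'" for \<rho>'
  proof -
    let ?F = "\<rho> \<inter> \<rho>'"
    have QF: "Q ?F" using \<rho> \<rho>' fan_Int(1)[OF S] by (auto simp: Q_def)
    have face: "\<rho> face_of convex_cone hull V"
      using \<rho> fan_Int(2)[OF S \<tau>, of \<rho>] V(2) by (simp add: Q_def Int_absorb1)
    \<comment> \<open>By minimality of the count, the smaller face keeps all generators of \<open>\<rho>\<close>.\<close>
    have "V \<inter> ?F = V \<inter> \<rho>"
      using V(1) least[OF QF] by (intro card_seteq) auto
    then have "\<rho> \<subseteq> ?F"
      using face_of_cone_hull_subset[OF face, of ?F] fan_convex_cone[OF S] QF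
      by (auto simp: Q_def)
    then show ?thesis by blast
  qed
  then show ?thesis using \<rho> that by (auto simp: Q_def)
qed

lemma
  assumes S: "fan S\<^sub>2" and f: "fan_morphism S\<^sub>1 S\<^sub>2 f" and \<sigma>: "\<sigma> \<in> S\<^sub>1"
  shows fcone_mem: "fcone S\<^sub>2 f \<sigma> \<in> S\<^sub>2"
    and fcone_image: "f ` \<sigma> \<subseteq> fcone S\<^sub>2 f \<sigma>"
    and fcone_least: "\<And>\<rho>. \<rho> \<in> S\<^sub>2 \<Longrightarrow> f ` \<sigma> \<subseteq> \<rho> \<Longrightarrow> fcone S\<^sub>2 f \<sigma> \<subseteq> \<rho>"
proof -
  obtain \<tau> where "\<tau> \<in> S\<^sub>2" "f ` \<sigma> \<subseteq> \<tau>"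
    using f \<sigma> by (auto simp: fan_morphism_def)
  then obtain \<rho> where \<rho>: "\<rho> \<in> S\<^sub>2" "f ` \<sigma> \<subseteq> \<rho>"
      "\<And>\<rho>'. \<rho>' \<in> S\<^sub>2 \<Longrightarrow> f ` \<sigma> \<subseteq> \<rho>' \<Longrightarrow> \<rho> \<subseteq> \<rho>'"
    using fan_least_cone[OF S] by metis
  have "fcone S\<^sub>2 f \<sigma> = \<rho>"
    unfolding fcone_def
  proof (rule the_equality)
    show "\<rho> \<in> S\<^sub>2 \<and> f ` \<sigma> \<subseteq> \<rho> \<and> (\<forall>\<rho>'\<in>S\<^sub>2. f ` \<sigma> \<subseteq> \<rho>' \<and> \<rho>' \<subseteq> \<rho> \<longrightarrow> \<rho>' = \<rho>)"
      using \<rho> by (metis subset_antisym)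
  next
    fix \<tau> assume \<tau>: "\<tau> \<in> S\<^sub>2 \<and> f ` \<sigma> \<subseteq> \<tau> \<and> (\<forall>\<rho>'\<in>S\<^sub>2. f ` \<sigma> \<subseteq> \<rho>' \<and> \<rho>' \<subseteq> \<tau> \<longrightarrow> \<rho>' = \<tau>)"
    then have "\<rho> \<subseteq> \<tau>" using \<rho>(3) by blast
    then show "\<tau> = \<rho>" using \<tau> \<rho>(1,2) by metis
  qed
  then show "fcone S\<^sub>2 f \<sigma> \<in> S\<^sub>2" "f ` \<sigma> \<subseteq> fcone S\<^sub>2 f \<sigma>"
      "\<And>\<rho>. \<rho> \<in> S\<^sub>2 \<Longrightarrow> f ` \<sigma> \<subseteq> \<rho> \<Longrightarrow> fcone S\<^sub>2 f \<sigma> \<subseteq> \<rho>"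
    using \<rho> by simp_all
qed

lemma fcone_mono:
  assumes "fan S\<^sub>2" "fan_morphism S\<^sub>1 S\<^sub>2 f" "\<sigma> \<in> S\<^sub>1" "\<kappa> \<in> S\<^sub>1" "\<sigma> \<subseteq> \<kappa>"
  shows "fcone S\<^sub>2 f \<sigma> \<subseteq> fcone S\<^sub>2 f \<kappa>"
  using assms fcone_image[OF assms(1,2,4)]
  by (intro fcone_least[OF assms(1,2,3)] fcone_mem[OF assms(1,2,4)]) blast

section \<open>Stars\<close>

lemma convex_cone_span_difference:
  assumes C: "convex_cone C" and x: "x \<in> span C"
  obtains s t where "s \<in> C" "t \<in> C" "x = s - t"
proof -
  let ?D = "{s - t | s t. s \<in> C \<and> t \<in> C}"
  have "subspace ?D"
    unfolding subspace_def
  proof (intro conjI ballI allI)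
    show "0 \<in> ?D" using convex_cone_contains_0[OF C] by force
  next
    fix a b assume "a \<in> ?D" "b \<in> ?D"
    then obtain s t s' t' where "a = s - t" "b = s' - t'" "s \<in> C" "t \<in> C" "s' \<in> C" "t' \<in> C"
      by blast
    then have "a + b = (s + s') - (t + t')" "s + s' \<in> C" "t + t' \<in> C"
      using convex_cone_add[OF C] by auto
    then show "a + b \<in> ?D" by blast
  next
    fix c :: real and a assume "a \<in> ?D"
    then obtain s t where st: "a = s - t" "s \<in> C" "t \<in> C" by blast
    show "c *\<^sub>R a \<in> ?D"
    proof (cases "c \<ge> 0")
      case True
      then have "c *\<^sub>R a = c *\<^sub>R s - c *\<^sub>R t" "c *\<^sub>R s \<in> C" "c *\<^sub>R t \<in> C"
        using st convex_cone_scaleR[OF C] by (auto simp: scaleR_diff_right)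
      then show ?thesis by blast
    next
      case False
      then have "c *\<^sub>R a = (- c) *\<^sub>R t - (- c) *\<^sub>R s" "(- c) *\<^sub>R t \<in> C" "(- c) *\<^sub>R s \<in> C"
        using st convex_cone_scaleR[OF C, of "- c"] by (auto simp: scaleR_diff_right)
      then show ?thesis by blast
    qed
  qed
  moreover have "C \<subseteq> ?D"
    using convex_cone_contains_0[OF C] by force
  ultimately have "span C \<subseteq> ?D" by (rule span_minimal[rotated])
  then show ?thesis using x that by blast
qed

text \<open>The projection along \<open>\<sigma>\<close> forgets nothing about the cones containing \<open>\<sigma>\<close>. If the projection of \<open>x\<close> lies in that of
  \<open>\<kappa>\<close>, then \<open>x + t = y + s\<close> with \<open>y \<in> \<kappa>\<close> and \<open>s, t \<in> \<sigma>\<close>. This point lies in \<open>\<tau> \<inter> \<kappa>\<close>, a face of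
  \<open>\<tau>\<close>, and a face contains the summands \<open>x, t \<in> \<tau>\<close> of its points.\<close>

lemma star_mem_of_cproj_mem:
  assumes S: "fan S" and \<sigma>: "\<sigma> \<in> S" and \<tau>: "\<tau> \<in> star S \<sigma>" and \<kappa>: "\<kappa> \<in> star S \<sigma>"
    and x: "x \<in> \<tau>" and px: "cproj \<sigma> x \<in> cproj \<sigma> ` \<kappa>"
  shows "x \<in> \<kappa>"
proof -
  have in_S: "\<tau> \<in> S" "\<kappa> \<in> S" "\<sigma> \<subseteq> \<tau>" "\<sigma> \<subseteq> \<kappa>"
    using \<tau> \<kappa> by (auto simp: star_def)
  obtain y where y: "y \<in> \<kappa>" "cproj \<sigma> x = cproj \<sigma> y" using px by blast
  have "x - y \<in> span \<sigma>"
    using y(2) cproj_eq_iff[OF fan_polyhedral[OF S \<sigma>]] by blast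
  then obtain s t where st: "s \<in> \<sigma>" "t \<in> \<sigma>" "x - y = s - t"
    using convex_cone_span_difference[OF fan_convex_cone[OF S \<sigma>]] by metis
  have "x + t = y + s" using st(3) by (simp add: algebra_simps)
  moreover have "x + t \<in> \<tau>"
    using convex_cone_add[OF fan_convex_cone[OF S in_S(1)] x] st(2) in_S(3) by blast
  moreover have "y + s \<in> \<kappa>"
    using convex_cone_add[OF fan_convex_cone[OF S in_S(2)] y(1)] st(1) in_S(4) by blast
  ultimately have "x + t \<in> \<tau> \<inter> \<kappa>" by simp
  moreover have "t \<in> \<tau>" using st(2) in_S(3) by blast
  ultimately have "x \<in> \<tau> \<inter> \<kappa>"
    using face_of_cone_add[OF fan_convex_cone[OF S in_S(1)] fan_Int(2)[OF S in_S(1,2)] x]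
    by blast
  then show ?thesis by simp
qed

lemma star_subset_iff_cproj:
  assumes "fan S" "\<sigma> \<in> S" "\<tau> \<in> star S \<sigma>" "\<kappa> \<in> star S \<sigma>"
  shows "cproj \<sigma> ` \<tau> \<subseteq> cproj \<sigma> ` \<kappa> \<longleftrightarrow> \<tau> \<subseteq> \<kappa>"
  using star_mem_of_cproj_mem[OF assms] by blast

lemma star_eq_iff_cproj:
  assumes "fan S" "\<sigma> \<in> S" "\<tau> \<in> star S \<sigma>" "\<kappa> \<in> star S \<sigma>"
  shows "cproj \<sigma> ` \<tau> = cproj \<sigma> ` \<kappa> \<longleftrightarrow> \<tau> = \<kappa>"
  using star_subset_iff_cproj[OF assms] star_subset_iff_cproj[OF assms(1,2,4,3)]
  by (metis subset_antisym subset_refl)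

lemma image_eq_coarser:
  assumes "\<And>x y. g x = g y \<Longrightarrow> h x = h y" and "g ` A = g ` B"
  shows "h ` A = h ` B"
proof -
  have "h ` A \<subseteq> h ` B" if eq: "g ` A = g ` B" for A B
  proof
    fix z assume "z \<in> h ` A"
    then obtain a where a: "a \<in> A" "z = h a" by blast
    then obtain b where b: "b \<in> B" "g a = g b" using eq by (metis imageE imageI)
    show "z \<in> h ` B" using a(2) b(1) assms(1)[OF b(2)] by simp
  qed
  then show ?thesis using assms(2) by (metis subset_antisym)
qed

section \<open>Equivalence of cones\<close>

lemma pequiv_sym: "pequiv S P \<sigma> \<kappa> \<Longrightarrow> pequiv S P \<kappa> \<sigma>"
  by (auto simp: pequiv_def)

lemma same_star_eq: "\<kappa> \<in> same_star S \<sigma> \<Longrightarrow> same_star S \<kappa> = same_star S \<sigma>"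
  by (simp add: same_star_def)

lemma Obj_fan_cat: "A \<in> Obj (fan_cat S P) \<longleftrightarrow> (\<exists>\<sigma>\<in>S. A = cls S P \<sigma>)"
  by (auto simp: fan_cat_def)

lemma cls_Obj: "\<sigma> \<in> S \<Longrightarrow> cls S P \<sigma> \<in> Obj (fan_cat S P)"
  by (auto simp: Obj_fan_cat)

context
  fixes S :: "'a::real_inner set set" and P :: "'a set set \<Rightarrow> 'a set set set"
  assumes pf: "partitioned_fan S P"
begin

lemma fanS: "fan S"
  using pf by (simp add: partitioned_fan_def simplicial_fan_def)

lemma pequiv_refl:
  assumes "\<sigma> \<in> S"
  shows "pequiv S P \<sigma> \<sigma>"
proof -
  have "\<sigma> \<in> \<Union>(P (same_star S \<sigma>))"
    using pf assms by (auto simp: partitioned_fan_def fan_partition_def partition_on_def same_star_def)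
  then show ?thesis using assms by (auto simp: pequiv_def)
qed

lemma pequiv_same_star:
  assumes "pequiv S P \<sigma> \<kappa>"
  shows "\<sigma> \<in> S" "\<kappa> \<in> S" "\<kappa> \<in> same_star S \<sigma>"
proof -
  obtain \<rho> b where b: "\<rho> \<in> S" "b \<in> P (same_star S \<rho>)" "\<sigma> \<in> b" "\<kappa> \<in> b"
    using assms by (auto simp: pequiv_def)
  have "\<Union>(P (same_star S \<rho>)) = same_star S \<rho>"
    using pf b(1) by (simp add: partitioned_fan_def fan_partition_def partition_on_def)
  then have "\<sigma> \<in> same_star S \<rho>" "\<kappa> \<in> same_star S \<rho>" using b by blast+
  then show "\<sigma> \<in> S" "\<kappa> \<in> S" "\<kappa> \<in> same_star S \<sigma>"
    by (simp_all add: same_star_def)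
qed

lemma pequiv_trans:
  assumes 1: "pequiv S P \<sigma> \<kappa>" and 2: "pequiv S P \<kappa> \<rho>"
  shows "pequiv S P \<sigma> \<rho>"
proof -
  have block: "\<exists>b\<in>P (same_star S \<kappa>). \<sigma> \<in> b \<and> \<kappa> \<in> b" if \<sigma>\<kappa>: "pequiv S P \<sigma> \<kappa>" for \<sigma>
  proof -
    obtain \<tau> b where b: "\<tau> \<in> S" "b \<in> P (same_star S \<tau>)" "\<sigma> \<in> b" "\<kappa> \<in> b"
      using \<sigma>\<kappa> by (auto simp: pequiv_def)
    have "\<Union>(P (same_star S \<tau>)) = same_star S \<tau>"
      using pf b(1) by (simp add: partitioned_fan_def fan_partition_def partition_on_def)
    then have "\<kappa> \<in> same_star S \<tau>" using b(2,4) by blast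
    then have "same_star S \<kappa> = same_star S \<tau>" by (rule same_star_eq)
    then show ?thesis using b by metis
  qed
  obtain b b' where b: "b \<in> P (same_star S \<kappa>)" "\<sigma> \<in> b" "\<kappa> \<in> b"
      and b': "b' \<in> P (same_star S \<kappa>)" "\<rho> \<in> b'" "\<kappa> \<in> b'"
    using block[OF 1] block[OF pequiv_sym[OF 2]] by blast
  have \<kappa>: "\<kappa> \<in> S" using 1 by (rule pequiv_same_star)
  then have "disjoint (P (same_star S \<kappa>))"
    using pf by (simp add: partitioned_fan_def fan_partition_def partition_on_def)
  then have "b = b'" using b b' by (auto simp: pairwise_def disjnt_iff)
  then show ?thesis using b b' \<kappa> by (auto simp: pequiv_def)
qed

text \<open>Equivalent cones have the same orthogonal complement by definition, and finite-dimensional subspaces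
  with the same complement coincide. Consequently the projections along equivalent cones are one map.\<close>

lemma pequiv_span: "pequiv S P \<sigma> \<kappa> \<Longrightarrow> span \<sigma> = span \<kappa>"
  using pequiv_same_star[of \<sigma> \<kappa>] fan_polyhedral[OF fanS]
  by (intro span_eq_of_cperp_eq) (simp_all add: same_star_def)

lemma pequiv_cproj: "pequiv S P \<sigma> \<kappa> \<Longrightarrow> cproj \<sigma> = cproj \<kappa>"
  by (intro cproj_cong_span pequiv_span)

text \<open>The lift exists because the two stars have the same projections; it is equivalent to \<open>\<kappa>\<close> by
  admissibility.\<close>

lemma pequiv_lift_star:
  assumes eq: "pequiv S P \<sigma> \<sigma>'" and \<kappa>: "\<kappa> \<in> star S \<sigma>"
  obtains \<kappa>' where "\<kappa>' \<in> star S \<sigma>'" "cproj \<sigma> ` \<kappa> = cproj \<sigma>' ` \<kappa>'" "pequiv S P \<kappa> \<kappa>'"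
proof -
  have "(\<lambda>\<tau>. cproj \<sigma> ` \<tau>) ` star S \<sigma> = (\<lambda>\<tau>. cproj \<sigma>' ` \<tau>) ` star S \<sigma>'"
    using pequiv_same_star(3)[OF eq] by (simp add: same_star_def)
  then have "cproj \<sigma> ` \<kappa> \<in> (\<lambda>\<tau>. cproj \<sigma>' ` \<tau>) ` star S \<sigma>'"
    using imageI[OF \<kappa>, of "\<lambda>\<tau>. cproj \<sigma> ` \<tau>"] by simp
  then obtain \<kappa>' where \<kappa>': "\<kappa>' \<in> star S \<sigma>'" "cproj \<sigma> ` \<kappa> = cproj \<sigma>' ` \<kappa>'"
    by (rule imageE) blast
  moreover have "pequiv S P \<kappa> \<kappa>'"
    using pf eq \<kappa> \<kappa>' unfolding partitioned_fan_def admissible_def by blast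
  ultimately show ?thesis by (rule that)
qed

lemma cls_eq_iff: "\<sigma> \<in> S \<Longrightarrow> \<kappa> \<in> S \<Longrightarrow> cls S P \<sigma> = cls S P \<kappa> \<longleftrightarrow> pequiv S P \<sigma> \<kappa>"
  unfolding cls_def set_eq_iff mem_Collect_eq by (metis pequiv_refl pequiv_sym pequiv_trans)

section \<open>The category of a partitioned fan\<close>

lemma mem_mor_iff:
  assumes "\<sigma> \<in> S" "\<kappa> \<in> S" "\<sigma> \<subseteq> \<kappa>"
  shows "(\<kappa>', \<sigma>') \<in> mor S P \<kappa> \<sigma> \<longleftrightarrow>
    pequiv S P \<sigma> \<sigma>' \<and> pequiv S P \<kappa> \<kappa>' \<and> \<sigma>' \<subseteq> \<kappa>' \<and> cproj \<sigma> ` \<kappa> = cproj \<sigma>' ` \<kappa>'"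
  using assms pequiv_refl by (auto simp: mor_def symrel_def symbols_def cls_def)

lemma mor_eq_iff:
  assumes "\<sigma> \<in> S" "\<kappa> \<in> S" "\<sigma> \<subseteq> \<kappa>" "\<sigma>' \<in> S" "\<kappa>' \<in> S" "\<sigma>' \<subseteq> \<kappa>'"
  shows "mor S P \<kappa> \<sigma> = mor S P \<kappa>' \<sigma>' \<longleftrightarrow>
    pequiv S P \<sigma> \<sigma>' \<and> pequiv S P \<kappa> \<kappa>' \<and> cproj \<sigma> ` \<kappa> = cproj \<sigma>' ` \<kappa>'"
proof
  assume "mor S P \<kappa> \<sigma> = mor S P \<kappa>' \<sigma>'"
  moreover have "(\<kappa>', \<sigma>') \<in> mor S P \<kappa>' \<sigma>'"
    using assms by (simp add: mem_mor_iff pequiv_refl)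
  ultimately have "(\<kappa>', \<sigma>') \<in> mor S P \<kappa> \<sigma>" by simp
  then show "pequiv S P \<sigma> \<sigma>' \<and> pequiv S P \<kappa> \<kappa>' \<and> cproj \<sigma> ` \<kappa> = cproj \<sigma>' ` \<kappa>'"
    using assms by (simp add: mem_mor_iff)
next
  assume *: "pequiv S P \<sigma> \<sigma>' \<and> pequiv S P \<kappa> \<kappa>' \<and> cproj \<sigma> ` \<kappa> = cproj \<sigma>' ` \<kappa>'"
  then have "pequiv S P \<sigma> \<tau> \<longleftrightarrow> pequiv S P \<sigma>' \<tau>" "pequiv S P \<kappa> \<tau> \<longleftrightarrow> pequiv S P \<kappa>' \<tau>" for \<tau>
    by (metis pequiv_sym pequiv_trans)+
  then show "mor S P \<kappa> \<sigma> = mor S P \<kappa>' \<sigma>'"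
    using assms * by (auto simp: mem_mor_iff)
qed

lemma Hom_fan_cat:
  assumes "A \<in> Obj (fan_cat S P)" "B \<in> Obj (fan_cat S P)"
  shows "m \<in> Hom (fan_cat S P) A B \<longleftrightarrow>
    (\<exists>\<sigma>\<in>S. \<exists>\<kappa>\<in>S. \<sigma> \<subseteq> \<kappa> \<and> A = cls S P \<sigma> \<and> B = cls S P \<kappa> \<and> m = mor S P \<kappa> \<sigma>)"
proof -
  obtain \<sigma>\<^sub>0 \<kappa>\<^sub>0 where A: "\<sigma>\<^sub>0 \<in> S" "A = cls S P \<sigma>\<^sub>0" and B: "\<kappa>\<^sub>0 \<in> S" "B = cls S P \<kappa>\<^sub>0"
    using assms by (auto simp: Obj_fan_cat)
  have memA: "\<sigma> \<in> A \<longleftrightarrow> \<sigma> \<in> S \<and> A = cls S P \<sigma>" for \<sigma>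
    using A cls_eq_iff pequiv_same_star(2) by (auto simp: cls_def)
  have memB: "\<kappa> \<in> B \<longleftrightarrow> \<kappa> \<in> S \<and> B = cls S P \<kappa>" for \<kappa>
    using B cls_eq_iff pequiv_same_star(2) by (auto simp: cls_def)
  have "m \<in> Hom (fan_cat S P) A B \<longleftrightarrow>
      (\<exists>\<kappa> \<sigma>. (\<kappa>, \<sigma>) \<in> symbols A B \<and> m = symrel A B `` {(\<kappa>, \<sigma>)})"
    by (auto simp: fan_cat_def quotient_def)
  also have "\<dots> \<longleftrightarrow> (\<exists>\<sigma>\<in>S. \<exists>\<kappa>\<in>S. \<sigma> \<subseteq> \<kappa> \<and> A = cls S P \<sigma> \<and> B = cls S P \<kappa> \<and> m = mor S P \<kappa> \<sigma>)"
    unfolding mor_def symbols_def using memA memB by (simp, metis)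
  finally show ?thesis .
qed

lemma mor_Hom:
  "\<sigma> \<in> S \<Longrightarrow> \<kappa> \<in> S \<Longrightarrow> \<sigma> \<subseteq> \<kappa> \<Longrightarrow>
    mor S P \<kappa> \<sigma> \<in> Hom (fan_cat S P) (cls S P \<sigma>) (cls S P \<kappa>)"
  by (auto simp: Hom_fan_cat cls_Obj)

text \<open>A morphism can be represented with any lower entry from the class of its domain: composable
  morphisms therefore have representatives that form a chain of cones.\<close>

lemma Hom_representative:
  assumes \<kappa>: "\<kappa> \<in> S" and B: "B \<in> Obj (fan_cat S P)" and m: "m \<in> Hom (fan_cat S P) (cls S P \<kappa>) B"
  obtains \<rho> where "\<rho> \<in> S" "\<kappa> \<subseteq> \<rho>" "B = cls S P \<rho>" "m = mor S P \<rho> \<kappa>"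
proof -
  obtain \<kappa>' \<rho>' where *: "\<kappa>' \<in> S" "\<rho>' \<in> S" "\<kappa>' \<subseteq> \<rho>'" "cls S P \<kappa> = cls S P \<kappa>'" "B = cls S P \<rho>'"
      "m = mor S P \<rho>' \<kappa>'"
    using m Hom_fan_cat[OF cls_Obj[OF \<kappa>] B] by blast
  then have eq: "pequiv S P \<kappa>' \<kappa>" and star: "\<rho>' \<in> star S \<kappa>'"
    using \<kappa> by (auto simp: cls_eq_iff star_def pequiv_sym)
  obtain \<rho> where \<rho>: "\<rho> \<in> star S \<kappa>" "cproj \<kappa>' ` \<rho>' = cproj \<kappa> ` \<rho>" "pequiv S P \<rho>' \<rho>"
    by (rule pequiv_lift_star[OF eq star])
  then have "\<rho> \<in> S" "\<kappa> \<subseteq> \<rho>" by (simp_all add: star_def)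
  with * \<kappa> eq \<rho>(2,3) show ?thesis
    by (intro that[of \<rho>]) (simp_all add: cls_eq_iff mor_eq_iff)
qed

text \<open>Composition is independent of representatives. Lift \<open>\<rho>'\<close> to a cone \<open>\<rho>''\<close> of the star of \<open>\<sigma>\<close> with
  the same projection along \<open>\<sigma>\<close>. It contains \<open>\<kappa>\<close>, since its projection contains that of \<open>\<kappa>\<close>; and
  projecting further, along \<open>\<kappa>\<close>, identifies it with \<open>\<rho>\<close>.\<close>

lemma comp_cproj_eq:
  assumes S: "\<sigma> \<in> S" "\<kappa> \<in> S" "\<rho> \<in> S" "\<sigma>' \<in> S" "\<kappa>' \<in> S" "\<rho>' \<in> S"
    and sub: "\<sigma> \<subseteq> \<kappa>" "\<kappa> \<subseteq> \<rho>" "\<sigma>' \<subseteq> \<kappa>'" "\<kappa>' \<subseteq> \<rho>'"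
    and eq: "pequiv S P \<sigma> \<sigma>'" "pequiv S P \<kappa> \<kappa>'"
    and p\<sigma>: "cproj \<sigma> ` \<kappa> = cproj \<sigma>' ` \<kappa>'" and p\<kappa>: "cproj \<kappa> ` \<rho> = cproj \<kappa>' ` \<rho>'"
  shows "cproj \<sigma> ` \<rho> = cproj \<sigma>' ` \<rho>'"
proof -
  have "\<rho>' \<in> star S \<sigma>'" using S sub by (auto simp: star_def)
  then obtain \<rho>'' where \<rho>'': "\<rho>'' \<in> star S \<sigma>" "cproj \<sigma>' ` \<rho>' = cproj \<sigma> ` \<rho>''"
    by (rule pequiv_lift_star[OF pequiv_sym[OF eq(1)]])
  have "cproj \<sigma> ` \<kappa> \<subseteq> cproj \<sigma> ` \<rho>''"
    unfolding p\<sigma> \<rho>''(2)[symmetric] using sub(4) by (rule image_mono)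
  then have \<kappa>\<rho>'': "\<kappa> \<subseteq> \<rho>''"
    using star_subset_iff_cproj[OF fanS S(1) _ \<rho>''(1), of \<kappa>] S sub by (simp add: star_def)
  have spans: "span \<sigma> \<subseteq> span \<kappa>" using sub(1) by (rule span_mono)
  have coarser: "cproj \<kappa> x = cproj \<kappa> y" if "cproj \<sigma> x = cproj \<sigma> y" for x y
    using that spans cproj_eq_iff[OF fan_polyhedral[OF fanS S(1)]]
      cproj_eq_iff[OF fan_polyhedral[OF fanS S(2)]] by blast
  have "cproj \<sigma> ` \<rho>' = cproj \<sigma> ` \<rho>''"
    using \<rho>''(2) pequiv_cproj[OF eq(1)] by simp
  then have "cproj \<kappa> ` \<rho>' = cproj \<kappa> ` \<rho>''"
    using coarser image_eq_coarser[of "cproj \<sigma>" "cproj \<kappa>"] by blast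
  then have "cproj \<kappa> ` \<rho> = cproj \<kappa> ` \<rho>''"
    using p\<kappa> pequiv_cproj[OF eq(2)] by simp
  then have "\<rho> = \<rho>''"
    using star_eq_iff_cproj[OF fanS S(2)] \<kappa>\<rho>'' \<rho>''(1) S sub by (simp add: star_def)
  then show ?thesis using \<rho>''(2) by simp
qed

lemma Cmp_mor:
  assumes S: "\<sigma> \<in> S" "\<kappa> \<in> S" "\<rho> \<in> S" and sub: "\<sigma> \<subseteq> \<kappa>" "\<kappa> \<subseteq> \<rho>"
  shows "Cmp (fan_cat S P) (mor S P \<rho> \<kappa>) (mor S P \<kappa> \<sigma>) = mor S P \<rho> \<sigma>"
proof -
  have "(THE m. \<exists>\<rho>' \<kappa>' \<sigma>'. (\<kappa>', \<sigma>') \<in> mor S P \<kappa> \<sigma> \<and> (\<rho>', \<kappa>') \<in> mor S P \<rho> \<kappa> \<and> m = mor S P \<rho>' \<sigma>')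
      = mor S P \<rho> \<sigma>"
  proof (rule the_equality)
    have "(\<kappa>, \<sigma>) \<in> mor S P \<kappa> \<sigma>" "(\<rho>, \<kappa>) \<in> mor S P \<rho> \<kappa>"
      using S sub by (simp_all add: mem_mor_iff pequiv_refl)
    then show "\<exists>\<rho>' \<kappa>' \<sigma>'. (\<kappa>', \<sigma>') \<in> mor S P \<kappa> \<sigma> \<and> (\<rho>', \<kappa>') \<in> mor S P \<rho> \<kappa> \<and>
        mor S P \<rho> \<sigma> = mor S P \<rho>' \<sigma>'" by metis
  next
    fix m
    assume "\<exists>\<rho>' \<kappa>' \<sigma>'. (\<kappa>', \<sigma>') \<in> mor S P \<kappa> \<sigma> \<and> (\<rho>', \<kappa>') \<in> mor S P \<rho> \<kappa> \<and> m = mor S P \<rho>' \<sigma>'"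
    then obtain \<rho>' \<kappa>' \<sigma>' where m: "m = mor S P \<rho>' \<sigma>'"
      and 1: "(\<kappa>', \<sigma>') \<in> mor S P \<kappa> \<sigma>" and 2: "(\<rho>', \<kappa>') \<in> mor S P \<rho> \<kappa>" by auto
    have 1: "pequiv S P \<sigma> \<sigma>'" "pequiv S P \<kappa> \<kappa>'" "\<sigma>' \<subseteq> \<kappa>'" "cproj \<sigma> ` \<kappa> = cproj \<sigma>' ` \<kappa>'"
      and 2: "pequiv S P \<rho> \<rho>'" "\<kappa>' \<subseteq> \<rho>'" "cproj \<kappa> ` \<rho> = cproj \<kappa>' ` \<rho>'"
      using 1 2 S sub by (simp_all add: mem_mor_iff)
    have S': "\<sigma>' \<in> S" "\<kappa>' \<in> S" "\<rho>' \<in> S"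
      using 1 2 pequiv_same_star(2) by blast+
    have "cproj \<sigma> ` \<rho> = cproj \<sigma>' ` \<rho>'"
      using comp_cproj_eq[OF S S' sub 1(3) 2(2) 1(1,2,4) 2(3)] .
    then have "mor S P \<rho> \<sigma> = mor S P \<rho>' \<sigma>'"
      using S S' sub 1 2 by (subst mor_eq_iff) auto
    then show "m = mor S P \<rho> \<sigma>" using m by simp
  qed
  then show ?thesis by (simp add: fan_cat_def)
qed

lemma cproj_self: "\<sigma> \<in> S \<Longrightarrow> cproj \<sigma> ` \<sigma> = {cproj \<sigma> 0}"
proof -
  assume \<sigma>: "\<sigma> \<in> S"
  have "cproj \<sigma> x = cproj \<sigma> 0" if "x \<in> \<sigma>" for x
    using that by (simp add: cproj_eq_iff[OF fan_polyhedral[OF fanS \<sigma>]] span_base)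
  moreover have "0 \<in> \<sigma>" using fan_convex_cone[OF fanS \<sigma>] by (rule convex_cone_contains_0)
  ultimately show ?thesis by blast
qed

lemma Idn_cls:
  assumes "\<sigma> \<in> S"
  shows "Idn (fan_cat S P) (cls S P \<sigma>) = mor S P \<sigma> \<sigma>"
proof -
  have "(THE m. \<exists>\<tau>\<in>cls S P \<sigma>. m = mor S P \<tau> \<tau>) = mor S P \<sigma> \<sigma>"
  proof (rule the_equality)
    show "\<exists>\<tau>\<in>cls S P \<sigma>. mor S P \<sigma> \<sigma> = mor S P \<tau> \<tau>"
      using pequiv_refl[OF assms] by (auto simp: cls_def)
  next
    fix m assume "\<exists>\<tau>\<in>cls S P \<sigma>. m = mor S P \<tau> \<tau>"
    then obtain \<tau> where \<tau>: "pequiv S P \<sigma> \<tau>" "m = mor S P \<tau> \<tau>" by (auto simp: cls_def)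
    then have "\<tau> \<in> S" using pequiv_same_star(2) by blast
    moreover from this have "cproj \<sigma> ` \<sigma> = cproj \<tau> ` \<tau>"
      using cproj_self[OF assms] cproj_self[of \<tau>] pequiv_cproj[OF \<tau>(1)] by metis
    ultimately show "m = mor S P \<sigma> \<sigma>"
      using \<tau> assms by (simp add: mor_eq_iff pequiv_sym)
  qed
  then show ?thesis by (simp add: fan_cat_def)
qed

lemma category_fan_cat: "category (fan_cat S P)"
  unfolding category_def
proof (intro conjI ballI impI)
  fix A B A' B'
  assume *: "A \<in> Obj (fan_cat S P)" "B \<in> Obj (fan_cat S P)" "A' \<in> Obj (fan_cat S P)"
    "B' \<in> Obj (fan_cat S P)" "Hom (fan_cat S P) A B \<inter> Hom (fan_cat S P) A' B' \<noteq> {}"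
  then obtain m where "m \<in> Hom (fan_cat S P) A B" "m \<in> Hom (fan_cat S P) A' B'" by blast
  then obtain \<sigma> \<kappa> \<sigma>' \<kappa>' where
    "\<sigma> \<in> S" "\<kappa> \<in> S" "\<sigma> \<subseteq> \<kappa>" "A = cls S P \<sigma>" "B = cls S P \<kappa>" "m = mor S P \<kappa> \<sigma>"
    "\<sigma>' \<in> S" "\<kappa>' \<in> S" "\<sigma>' \<subseteq> \<kappa>'" "A' = cls S P \<sigma>'" "B' = cls S P \<kappa>'" "m = mor S P \<kappa>' \<sigma>'"
    using Hom_fan_cat[OF *(1,2)] Hom_fan_cat[OF *(3,4)] by auto
  then show "A = A'" "B = B'" by (simp_all add: mor_eq_iff cls_eq_iff pequiv_sym)
next
  fix A assume "A \<in> Obj (fan_cat S P)"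
  then show "Idn (fan_cat S P) A \<in> Hom (fan_cat S P) A A"
    by (auto simp: Obj_fan_cat Idn_cls mor_Hom)
next
  fix A B D g h
  assume *: "A \<in> Obj (fan_cat S P)" "B \<in> Obj (fan_cat S P)" "D \<in> Obj (fan_cat S P)"
    "g \<in> Hom (fan_cat S P) A B" "h \<in> Hom (fan_cat S P) B D"
  obtain \<sigma> \<kappa> where 1: "\<sigma> \<in> S" "\<kappa> \<in> S" "\<sigma> \<subseteq> \<kappa>" "A = cls S P \<sigma>" "B = cls S P \<kappa>" "g = mor S P \<kappa> \<sigma>"
    using * Hom_fan_cat by blast
  obtain \<rho> where 2: "\<rho> \<in> S" "\<kappa> \<subseteq> \<rho>" "D = cls S P \<rho>" "h = mor S P \<rho> \<kappa>"
    using Hom_representative[OF 1(2) *(3)] *(5) 1(5) by metis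
  have "\<sigma> \<subseteq> \<rho>" using 1 2 by blast
  then show "Cmp (fan_cat S P) h g \<in> Hom (fan_cat S P) A D"
    using 1 2 by (simp add: Cmp_mor mor_Hom)
next
  fix A B g
  assume *: "A \<in> Obj (fan_cat S P)" "B \<in> Obj (fan_cat S P)" "g \<in> Hom (fan_cat S P) A B"
  obtain \<sigma> \<kappa> where "\<sigma> \<in> S" "\<kappa> \<in> S" "\<sigma> \<subseteq> \<kappa>" "A = cls S P \<sigma>" "B = cls S P \<kappa>" "g = mor S P \<kappa> \<sigma>"
    using * Hom_fan_cat by blast
  then show "Cmp (fan_cat S P) g (Idn (fan_cat S P) A) = g"
    "Cmp (fan_cat S P) (Idn (fan_cat S P) B) g = g"
    by (simp_all add: Idn_cls Cmp_mor)
next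
  fix A B D E g h k
  assume *: "A \<in> Obj (fan_cat S P)" "B \<in> Obj (fan_cat S P)" "D \<in> Obj (fan_cat S P)"
    "E \<in> Obj (fan_cat S P)" "g \<in> Hom (fan_cat S P) A B" "h \<in> Hom (fan_cat S P) B D"
    "k \<in> Hom (fan_cat S P) D E"
  obtain \<sigma> \<kappa> where 1: "\<sigma> \<in> S" "\<kappa> \<in> S" "\<sigma> \<subseteq> \<kappa>" "A = cls S P \<sigma>" "B = cls S P \<kappa>" "g = mor S P \<kappa> \<sigma>"
    using * Hom_fan_cat by blast
  obtain \<rho> where 2: "\<rho> \<in> S" "\<kappa> \<subseteq> \<rho>" "D = cls S P \<rho>" "h = mor S P \<rho> \<kappa>"
    using Hom_representative[OF 1(2) *(3)] *(6) 1(5) by metis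
  obtain \<tau> where 3: "\<tau> \<in> S" "\<rho> \<subseteq> \<tau>" "E = cls S P \<tau>" "k = mor S P \<tau> \<rho>"
    using Hom_representative[OF 2(1) *(4)] *(7) 2(3) by metis
  have "\<sigma> \<subseteq> \<rho>" "\<kappa> \<subseteq> \<tau>" using 1 2 3 by blast+
  then show "Cmp (fan_cat S P) k (Cmp (fan_cat S P) h g) = Cmp (fan_cat S P) (Cmp (fan_cat S P) k h) g"
    using 1 2 3 by (simp add: Cmp_mor)
qed

text \<open>A morphism out of the class of \<open>\<mu>\<close> has a representative with lower entry \<open>\<mu>\<close> itself, and
  maximality forces its upper entry to be \<open>\<mu>\<close> too.\<close>

lemma Hom_maximal_cone:
  assumes \<mu>: "maximal_cone S \<mu>" and B: "B \<in> Obj (fan_cat S P)"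
    and ne: "Hom (fan_cat S P) (cls S P \<mu>) B \<noteq> {}"
  shows "B = cls S P \<mu>"
proof -
  have \<mu>S: "\<mu> \<in> S" using \<mu> by (simp add: maximal_cone_def)
  obtain m where "m \<in> Hom (fan_cat S P) (cls S P \<mu>) B" using ne by blast
  then obtain \<rho> where "\<rho> \<in> S" "\<mu> \<subseteq> \<rho>" "B = cls S P \<rho>"
    using Hom_representative[OF \<mu>S B] by metis
  then show ?thesis using \<mu> by (auto simp: maximal_cone_def)
qed

end

lemma isomorphic_in_refl:
  assumes "category C" "A \<in> Obj C"
  shows "isomorphic_in C A A"
  using assms unfolding category_def isomorphic_in_def by (metis (no_types, lifting))

section \<open>The induced functor\<close>

context
  fixes S\<^sub>1 :: "'a::real_inner set set" and P\<^sub>1 :: "'a set set \<Rightarrow> 'a set set set"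
    and S\<^sub>2 :: "'b::real_inner set set" and P\<^sub>2 :: "'b set set \<Rightarrow> 'b set set set"
    and f :: "'a \<Rightarrow> 'b"
  assumes pf1: "partitioned_fan S\<^sub>1 P\<^sub>1" and pf2: "partitioned_fan S\<^sub>2 P\<^sub>2"
    and pm: "pfan_morphism S\<^sub>1 P\<^sub>1 S\<^sub>2 P\<^sub>2 f"
begin

lemma underlying_fan_morphism: "fan_morphism S\<^sub>1 S\<^sub>2 f"
  using pm by (simp add: pfan_morphism_def)

lemmas fcone_S2 = fcone_mem[OF fanS[OF pf2] underlying_fan_morphism]

lemmas fcone_sub = fcone_mono[OF fanS[OF pf2] underlying_fan_morphism]

lemma fcone_pequiv:
  "pequiv S\<^sub>1 P\<^sub>1 \<sigma> \<sigma>' \<Longrightarrow> pequiv S\<^sub>2 P\<^sub>2 (fcone S\<^sub>2 f \<sigma>) (fcone S\<^sub>2 f \<sigma>')"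
  using pm by (simp add: pfan_morphism_def)

text \<open>Lift \<open>\<kappa>\<^sup>f\<close> to a cone \<open>\<tau>\<close> of the star of \<open>\<sigma>'\<^sup>f\<close> with the same projection; the claim is that
  \<open>\<kappa>'\<^sup>f \<subseteq> \<tau>\<close>, that is, \<open>f(\<kappa>') \<subseteq> \<tau>\<close>. A point of \<open>\<kappa>'\<close> differs from one of \<open>\<kappa>\<close> by an element of
  the span of \<open>\<sigma>\<close>, which \<open>f\<close> maps into the span of \<open>\<sigma>\<^sup>f\<close>. So the projection of its image lies in that of \<open>\<tau>\<close>, and being
  a point of \<open>\<kappa>'\<^sup>f\<close>, a cone of the same star, it lies in \<open>\<tau>\<close>.\<close>

lemma fcone_cproj_subset:
  assumes S: "\<sigma> \<in> S\<^sub>1" "\<kappa> \<in> S\<^sub>1" "\<sigma>' \<in> S\<^sub>1" "\<kappa>' \<in> S\<^sub>1" and sub: "\<sigma> \<subseteq> \<kappa>" "\<sigma>' \<subseteq> \<kappa>'"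
    and eq: "pequiv S\<^sub>1 P\<^sub>1 \<sigma> \<sigma>'" and p: "cproj \<sigma> ` \<kappa> = cproj \<sigma>' ` \<kappa>'"
  shows "cproj (fcone S\<^sub>2 f \<sigma>') ` fcone S\<^sub>2 f \<kappa>' \<subseteq> cproj (fcone S\<^sub>2 f \<sigma>) ` fcone S\<^sub>2 f \<kappa>"
proof -
  let ?\<sigma> = "fcone S\<^sub>2 f \<sigma>" and ?\<kappa> = "fcone S\<^sub>2 f \<kappa>" and ?\<sigma>' = "fcone S\<^sub>2 f \<sigma>'" and ?\<kappa>' = "fcone S\<^sub>2 f \<kappa>'"
  have lin: "linear f" using underlying_fan_morphism by (simp add: fan_morphism_def)
  have eq2: "pequiv S\<^sub>2 P\<^sub>2 ?\<sigma> ?\<sigma>'" using eq by (rule fcone_pequiv)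
  have star: "?\<kappa> \<in> star S\<^sub>2 ?\<sigma>" and star': "?\<kappa>' \<in> star S\<^sub>2 ?\<sigma>'"
    using S sub by (simp_all add: star_def fcone_S2 fcone_sub)
  obtain \<tau> where \<tau>: "\<tau> \<in> star S\<^sub>2 ?\<sigma>'" "cproj ?\<sigma> ` ?\<kappa> = cproj ?\<sigma>' ` \<tau>"
    by (rule pequiv_lift_star[OF pf2 eq2 star])
  have "f x' \<in> \<tau>" if x': "x' \<in> \<kappa>'" for x'
  proof -
    have "cproj \<sigma> x' \<in> cproj \<sigma> ` \<kappa>"
      using x' p pequiv_cproj[OF pf1 eq] by simp
    then obtain x where x: "x \<in> \<kappa>" "cproj \<sigma> x' = cproj \<sigma> x" by blast
    then have "x' - x \<in> span \<sigma>"
      using cproj_eq_iff[OF fan_polyhedral[OF fanS[OF pf1] S(1)]] by blast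
    then have "f (x' - x) \<in> span (f ` \<sigma>)"
      using linear_span_image[OF lin] by blast
    then have "f x' - f x \<in> span ?\<sigma>"
      using span_mono[OF fcone_image[OF fanS[OF pf2] underlying_fan_morphism S(1)]] linear_diff[OF lin] by auto
    then have "cproj ?\<sigma> (f x') = cproj ?\<sigma> (f x)"
      using cproj_eq_iff[OF fan_polyhedral[OF fanS[OF pf2] fcone_S2[OF S(1)]]] by blast
    moreover have "f x \<in> ?\<kappa>" using fcone_image[OF fanS[OF pf2] underlying_fan_morphism S(2)] x(1) by blast
    ultimately have "cproj ?\<sigma>' (f x') \<in> cproj ?\<sigma>' ` \<tau>"
      using \<tau>(2) pequiv_cproj[OF pf2 eq2] by auto
    moreover have "f x' \<in> ?\<kappa>'" using fcone_image[OF fanS[OF pf2] underlying_fan_morphism S(4)] x' by blast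
    ultimately show ?thesis
      using star_mem_of_cproj_mem[OF fanS[OF pf2] fcone_S2[OF S(3)] star' \<tau>(1)] by blast
  qed
  then have "?\<kappa>' \<subseteq> \<tau>"
    using fcone_least[OF fanS[OF pf2] underlying_fan_morphism S(4)] \<tau>(1) by (auto simp: star_def)
  then show ?thesis unfolding \<tau>(2) by (rule image_mono)
qed

lemma fcone_mor_cong:
  assumes S: "\<sigma> \<in> S\<^sub>1" "\<kappa> \<in> S\<^sub>1" "\<sigma> \<subseteq> \<kappa>" "\<sigma>' \<in> S\<^sub>1" "\<kappa>' \<in> S\<^sub>1" "\<sigma>' \<subseteq> \<kappa>'"
    and eq: "mor S\<^sub>1 P\<^sub>1 \<kappa> \<sigma> = mor S\<^sub>1 P\<^sub>1 \<kappa>' \<sigma>'"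
  shows "mor S\<^sub>2 P\<^sub>2 (fcone S\<^sub>2 f \<kappa>) (fcone S\<^sub>2 f \<sigma>) = mor S\<^sub>2 P\<^sub>2 (fcone S\<^sub>2 f \<kappa>') (fcone S\<^sub>2 f \<sigma>')"
proof -
  have *: "pequiv S\<^sub>1 P\<^sub>1 \<sigma> \<sigma>'" "pequiv S\<^sub>1 P\<^sub>1 \<kappa> \<kappa>'" "cproj \<sigma> ` \<kappa> = cproj \<sigma>' ` \<kappa>'"
    using eq S by (simp_all add: mor_eq_iff[OF pf1])
  have "cproj (fcone S\<^sub>2 f \<sigma>) ` fcone S\<^sub>2 f \<kappa> = cproj (fcone S\<^sub>2 f \<sigma>') ` fcone S\<^sub>2 f \<kappa>'"
    using fcone_cproj_subset[OF S(1,2,4,5,3,6) *(1,3)]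
      fcone_cproj_subset[OF S(4,5,1,2,6,3) pequiv_sym[OF *(1)] *(3)[symmetric]]
    by (rule subset_antisym[rotated])
  then show ?thesis
    using S * by (simp add: mor_eq_iff[OF pf2] fcone_S2 fcone_sub fcone_pequiv)
qed

abbreviation (input) "CF \<equiv> induced_functor S\<^sub>1 P\<^sub>1 S\<^sub>2 P\<^sub>2 f"

lemma omap_induced:
  assumes "\<sigma> \<in> S\<^sub>1"
  shows "omap CF (cls S\<^sub>1 P\<^sub>1 \<sigma>) = cls S\<^sub>2 P\<^sub>2 (fcone S\<^sub>2 f \<sigma>)"
proof -
  have "(THE B. \<exists>\<sigma>'\<in>S\<^sub>1. cls S\<^sub>1 P\<^sub>1 \<sigma> = cls S\<^sub>1 P\<^sub>1 \<sigma>' \<and> B = cls S\<^sub>2 P\<^sub>2 (fcone S\<^sub>2 f \<sigma>'))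
      = cls S\<^sub>2 P\<^sub>2 (fcone S\<^sub>2 f \<sigma>)"
  proof (rule the_equality)
    fix B assume "\<exists>\<sigma>'\<in>S\<^sub>1. cls S\<^sub>1 P\<^sub>1 \<sigma> = cls S\<^sub>1 P\<^sub>1 \<sigma>' \<and> B = cls S\<^sub>2 P\<^sub>2 (fcone S\<^sub>2 f \<sigma>')"
    then obtain \<sigma>' where "\<sigma>' \<in> S\<^sub>1" "pequiv S\<^sub>1 P\<^sub>1 \<sigma> \<sigma>'" "B = cls S\<^sub>2 P\<^sub>2 (fcone S\<^sub>2 f \<sigma>')"
      using assms cls_eq_iff[OF pf1] by blast
    then show "B = cls S\<^sub>2 P\<^sub>2 (fcone S\<^sub>2 f \<sigma>)"
      using assms by (metis cls_eq_iff[OF pf2] fcone_S2 fcone_pequiv)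
  qed (use assms in blast)
  then show ?thesis by (simp add: induced_functor_def)
qed

lemma amap_induced:
  assumes "\<sigma> \<in> S\<^sub>1" "\<kappa> \<in> S\<^sub>1" "\<sigma> \<subseteq> \<kappa>"
  shows "amap CF (mor S\<^sub>1 P\<^sub>1 \<kappa> \<sigma>) = mor S\<^sub>2 P\<^sub>2 (fcone S\<^sub>2 f \<kappa>) (fcone S\<^sub>2 f \<sigma>)"
proof -
  have "(THE n. \<exists>\<sigma>'\<in>S\<^sub>1. \<exists>\<kappa>'\<in>S\<^sub>1. \<sigma>' \<subseteq> \<kappa>' \<and> mor S\<^sub>1 P\<^sub>1 \<kappa> \<sigma> = mor S\<^sub>1 P\<^sub>1 \<kappa>' \<sigma>' \<and>
               n = mor S\<^sub>2 P\<^sub>2 (fcone S\<^sub>2 f \<kappa>') (fcone S\<^sub>2 f \<sigma>'))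
      = mor S\<^sub>2 P\<^sub>2 (fcone S\<^sub>2 f \<kappa>) (fcone S\<^sub>2 f \<sigma>)"
  proof (rule the_equality)
    fix n assume "\<exists>\<sigma>'\<in>S\<^sub>1. \<exists>\<kappa>'\<in>S\<^sub>1. \<sigma>' \<subseteq> \<kappa>' \<and> mor S\<^sub>1 P\<^sub>1 \<kappa> \<sigma> = mor S\<^sub>1 P\<^sub>1 \<kappa>' \<sigma>' \<and>
               n = mor S\<^sub>2 P\<^sub>2 (fcone S\<^sub>2 f \<kappa>') (fcone S\<^sub>2 f \<sigma>')"
    then show "n = mor S\<^sub>2 P\<^sub>2 (fcone S\<^sub>2 f \<kappa>) (fcone S\<^sub>2 f \<sigma>)"
      using assms fcone_mor_cong by blast
  qed (use assms in blast)
  then show ?thesis by (simp add: induced_functor_def)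
qed

lemma is_functor_induced: "is_functor (fan_cat S\<^sub>1 P\<^sub>1) (fan_cat S\<^sub>2 P\<^sub>2) CF"
  unfolding is_functor_def
proof (intro conjI ballI)
  show "category (fan_cat S\<^sub>1 P\<^sub>1)" "category (fan_cat S\<^sub>2 P\<^sub>2)"
    by (rule category_fan_cat[OF pf1], rule category_fan_cat[OF pf2])
next
  fix A assume "A \<in> Obj (fan_cat S\<^sub>1 P\<^sub>1)"
  then obtain \<sigma> where "\<sigma> \<in> S\<^sub>1" "A = cls S\<^sub>1 P\<^sub>1 \<sigma>" using Obj_fan_cat by blast
  then show "omap CF A \<in> Obj (fan_cat S\<^sub>2 P\<^sub>2)"
      "amap CF (Idn (fan_cat S\<^sub>1 P\<^sub>1) A) = Idn (fan_cat S\<^sub>2 P\<^sub>2) (omap CF A)"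
    by (simp_all add: omap_induced amap_induced Idn_cls[OF pf1] Idn_cls[OF pf2] cls_Obj fcone_S2)
next
  fix A B m
  assume "A \<in> Obj (fan_cat S\<^sub>1 P\<^sub>1)" "B \<in> Obj (fan_cat S\<^sub>1 P\<^sub>1)" "m \<in> Hom (fan_cat S\<^sub>1 P\<^sub>1) A B"
  then obtain \<sigma> \<kappa> where "\<sigma> \<in> S\<^sub>1" "\<kappa> \<in> S\<^sub>1" "\<sigma> \<subseteq> \<kappa>" "A = cls S\<^sub>1 P\<^sub>1 \<sigma>" "B = cls S\<^sub>1 P\<^sub>1 \<kappa>"
      "m = mor S\<^sub>1 P\<^sub>1 \<kappa> \<sigma>"
    using Hom_fan_cat[OF pf1] by blast
  then show "amap CF m \<in> Hom (fan_cat S\<^sub>2 P\<^sub>2) (omap CF A) (omap CF B)"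
    by (simp add: omap_induced amap_induced mor_Hom[OF pf2] fcone_S2 fcone_sub)
next
  fix A B E m n
  assume *: "A \<in> Obj (fan_cat S\<^sub>1 P\<^sub>1)" "B \<in> Obj (fan_cat S\<^sub>1 P\<^sub>1)" "E \<in> Obj (fan_cat S\<^sub>1 P\<^sub>1)"
    "m \<in> Hom (fan_cat S\<^sub>1 P\<^sub>1) A B" "n \<in> Hom (fan_cat S\<^sub>1 P\<^sub>1) B E"
  then obtain \<sigma> \<kappa> where 1: "\<sigma> \<in> S\<^sub>1" "\<kappa> \<in> S\<^sub>1" "\<sigma> \<subseteq> \<kappa>" "B = cls S\<^sub>1 P\<^sub>1 \<kappa>" "m = mor S\<^sub>1 P\<^sub>1 \<kappa> \<sigma>"
    using Hom_fan_cat[OF pf1] by blast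
  obtain \<rho> where 2: "\<rho> \<in> S\<^sub>1" "\<kappa> \<subseteq> \<rho>" "n = mor S\<^sub>1 P\<^sub>1 \<rho> \<kappa>"
    using Hom_representative[OF pf1 1(2) *(3)] *(5) 1(4) by metis
  have "\<sigma> \<subseteq> \<rho>" using 1 2 by blast
  then show "amap CF (Cmp (fan_cat S\<^sub>1 P\<^sub>1) n m) = Cmp (fan_cat S\<^sub>2 P\<^sub>2) (amap CF n) (amap CF m)"
    using 1 2 by (simp add: amap_induced Cmp_mor[OF pf1] Cmp_mor[OF pf2] fcone_S2 fcone_sub)
qed

text \<open>Parallel morphisms can be given the same lower entry \<open>\<sigma>\<close>. Their images then have the same lower
  entry as well, so they agree only if their upper entries do, by injectivity of the projection on a
  star.\<close>

lemma faithful_induced: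
  assumes inj: "injective_fan_morphism S\<^sub>1 S\<^sub>2 f"
  shows "faithful (fan_cat S\<^sub>1 P\<^sub>1) (fan_cat S\<^sub>2 P\<^sub>2) CF"
  unfolding faithful_def
proof (intro conjI ballI inj_onI is_functor_induced)
  fix A B m n
  assume *: "A \<in> Obj (fan_cat S\<^sub>1 P\<^sub>1)" "B \<in> Obj (fan_cat S\<^sub>1 P\<^sub>1)" "m \<in> Hom (fan_cat S\<^sub>1 P\<^sub>1) A B"
    "n \<in> Hom (fan_cat S\<^sub>1 P\<^sub>1) A B" and eq: "amap CF m = amap CF n"
  obtain \<sigma> where \<sigma>: "\<sigma> \<in> S\<^sub>1" "A = cls S\<^sub>1 P\<^sub>1 \<sigma>" using *(1) Obj_fan_cat by blast
  obtain \<kappa> where \<kappa>: "\<kappa> \<in> S\<^sub>1" "\<sigma> \<subseteq> \<kappa>" "m = mor S\<^sub>1 P\<^sub>1 \<kappa> \<sigma>"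
    using Hom_representative[OF pf1 \<sigma>(1) *(2)] *(3) \<sigma>(2) by metis
  obtain \<kappa>' where \<kappa>': "\<kappa>' \<in> S\<^sub>1" "\<sigma> \<subseteq> \<kappa>'" "n = mor S\<^sub>1 P\<^sub>1 \<kappa>' \<sigma>"
    using Hom_representative[OF pf1 \<sigma>(1) *(2)] *(4) \<sigma>(2) by metis
  have "cproj (fcone S\<^sub>2 f \<sigma>) ` fcone S\<^sub>2 f \<kappa> = cproj (fcone S\<^sub>2 f \<sigma>) ` fcone S\<^sub>2 f \<kappa>'"
    using eq \<sigma> \<kappa> \<kappa>' by (simp add: amap_induced mor_eq_iff[OF pf2] fcone_S2 fcone_sub)
  then have "fcone S\<^sub>2 f \<kappa> = fcone S\<^sub>2 f \<kappa>'"
    using star_eq_iff_cproj[OF fanS[OF pf2] fcone_S2[OF \<sigma>(1)]] \<sigma> \<kappa> \<kappa>'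
    by (simp add: star_def fcone_S2 fcone_sub)
  then have "\<kappa> = \<kappa>'" using inj \<kappa>(1) \<kappa>'(1) by (simp add: injective_fan_morphism_def)
  then show "m = n" using \<kappa> \<kappa>' by simp
qed

lemma dense_induced:
  assumes "surjective_fan_morphism S\<^sub>1 S\<^sub>2 f"
  shows "dense_functor (fan_cat S\<^sub>1 P\<^sub>1) (fan_cat S\<^sub>2 P\<^sub>2) CF"
  unfolding dense_functor_def
proof (intro conjI is_functor_induced subset_antisym subsetI)
  fix B assume B: "B \<in> Obj (fan_cat S\<^sub>2 P\<^sub>2)"
  then obtain \<tau> where "\<tau> \<in> S\<^sub>2" "B = cls S\<^sub>2 P\<^sub>2 \<tau>" using Obj_fan_cat by blast
  then obtain \<sigma> where \<sigma>: "\<sigma> \<in> S\<^sub>1" "B = cls S\<^sub>2 P\<^sub>2 (fcone S\<^sub>2 f \<sigma>)"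
    using assms by (auto simp: surjective_fan_morphism_def)
  then have "isomorphic_in (fan_cat S\<^sub>2 P\<^sub>2) (omap CF (cls S\<^sub>1 P\<^sub>1 \<sigma>)) B"
    using isomorphic_in_refl[OF category_fan_cat[OF pf2] B] by (simp add: omap_induced)
  then show "B \<in> essential_image (fan_cat S\<^sub>1 P\<^sub>1) (fan_cat S\<^sub>2 P\<^sub>2) CF"
    using B cls_Obj[OF \<sigma>(1)] unfolding essential_image_def by blast
qed (simp add: essential_image_def)

end

section \<open>Right adjoints and maximal cones\<close>

lemma right_adjoint_unit_nonempty:
  assumes adj: "right_adjoint C D F R" and A: "A \<in> Obj C"
  shows "Hom C A (omap R (omap F A)) \<noteq> {}"
proof -
  have D: "category D" and FA: "omap F A \<in> Obj D"
    using adj A by (simp_all add: right_adjoint_def is_functor_def)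
  obtain \<phi> where "bij_betw \<phi> (Hom D (omap F A) (omap F A)) (Hom C A (omap R (omap F A)))"
    using adj A FA unfolding right_adjoint_def by blast
  moreover have "Idn D (omap F A) \<in> Hom D (omap F A) (omap F A)"
    using D FA by (simp add: category_def)
  ultimately show ?thesis using bij_betwE by blast
qed

text \<open>The unit is a morphism out of the class of the maximal cone, so its codomain is that class.\<close>

lemma maximal_cone_in_essential_image:
  assumes pf: "partitioned_fan S P" and adj: "right_adjoint (fan_cat S P) D F R"
    and \<mu>: "maximal_cone S \<mu>"
  shows "cls S P \<mu> \<in> essential_image D (fan_cat S P) R"
proof -
  let ?A = "cls S P \<mu>"
  have A: "?A \<in> Obj (fan_cat S P)" using \<mu> by (simp add: cls_Obj maximal_cone_def)
  have FA: "omap F ?A \<in> Obj D" and RFA: "omap R (omap F ?A) \<in> Obj (fan_cat S P)"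
    using adj A by (simp_all add: right_adjoint_def is_functor_def)
  have "omap R (omap F ?A) = ?A"
    using Hom_maximal_cone[OF pf \<mu> RFA right_adjoint_unit_nonempty[OF adj A]] .
  then have "isomorphic_in (fan_cat S P) (omap R (omap F ?A)) ?A"
    using isomorphic_in_refl[OF category_fan_cat[OF pf] A] by simp
  then show ?thesis using A FA unfolding essential_image_def by blast
qed

theorem theorem5p7:
  fixes N\<^sub>1 :: "'a::real_inner set" and N\<^sub>2 :: "'b::real_inner set"
    and S\<^sub>1 :: "'a set set" and P\<^sub>1 :: "'a set set \<Rightarrow> 'a set set set"
    and S\<^sub>2 :: "'b set set" and P\<^sub>2 :: "'b set set \<Rightarrow> 'b set set set"
    and f :: "'a \<Rightarrow> 'b"
  assumes "lattice_of_finite_rank N\<^sub>1" and "lattice_of_finite_rank N\<^sub>2"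
    and "partitioned_fan S\<^sub>1 P\<^sub>1" and "partitioned_fan S\<^sub>2 P\<^sub>2"
    and "pfan_morphism S\<^sub>1 P\<^sub>1 S\<^sub>2 P\<^sub>2 f"
  shows
    "(is_functor (fan_cat S\<^sub>1 P\<^sub>1) (fan_cat S\<^sub>2 P\<^sub>2) (induced_functor S\<^sub>1 P\<^sub>1 S\<^sub>2 P\<^sub>2 f) \<and>
      (\<forall>\<sigma>\<in>S\<^sub>1. omap (induced_functor S\<^sub>1 P\<^sub>1 S\<^sub>2 P\<^sub>2 f) (cls S\<^sub>1 P\<^sub>1 \<sigma>) =
               cls S\<^sub>2 P\<^sub>2 (fcone S\<^sub>2 f \<sigma>)) \<and>
      (\<forall>\<sigma>\<in>S\<^sub>1. \<forall>\<kappa>\<in>S\<^sub>1. \<sigma> \<subseteq> \<kappa> \<longrightarrow>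
         amap (induced_functor S\<^sub>1 P\<^sub>1 S\<^sub>2 P\<^sub>2 f) (mor S\<^sub>1 P\<^sub>1 \<kappa> \<sigma>) =
         mor S\<^sub>2 P\<^sub>2 (fcone S\<^sub>2 f \<kappa>) (fcone S\<^sub>2 f \<sigma>))) \<and>
     (injective_fan_morphism S\<^sub>1 S\<^sub>2 f \<longrightarrow>
        faithful (fan_cat S\<^sub>1 P\<^sub>1) (fan_cat S\<^sub>2 P\<^sub>2) (induced_functor S\<^sub>1 P\<^sub>1 S\<^sub>2 P\<^sub>2 f)) \<and>
     (surjective_fan_morphism S\<^sub>1 S\<^sub>2 f \<longrightarrow>
        dense_functor (fan_cat S\<^sub>1 P\<^sub>1) (fan_cat S\<^sub>2 P\<^sub>2) (induced_functor S\<^sub>1 P\<^sub>1 S\<^sub>2 P\<^sub>2 f)) \<and>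
     (\<forall>R. right_adjoint (fan_cat S\<^sub>1 P\<^sub>1) (fan_cat S\<^sub>2 P\<^sub>2) (induced_functor S\<^sub>1 P\<^sub>1 S\<^sub>2 P\<^sub>2 f) R \<longrightarrow>
        (\<forall>\<mu>. maximal_cone S\<^sub>1 \<mu> \<longrightarrow>
           cls S\<^sub>1 P\<^sub>1 \<mu> \<in> essential_image (fan_cat S\<^sub>2 P\<^sub>2) (fan_cat S\<^sub>1 P\<^sub>1) R))"
proof -
  note pf = assms(3,4,5)
  show ?thesis
    using is_functor_induced[OF pf] omap_induced[OF pf] amap_induced[OF pf] faithful_induced[OF pf]
      dense_induced[OF pf] maximal_cone_in_essential_image[OF assms(3)]
    by (intro conjI allI ballI impI) simp_all
qed

end
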